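(* Let $a$ be the minimum area of a convex set in the Euclidean plane that is a covering for all point sets of unit diameter, i.e. that contains a subset congruent to every planar point set of diameter $1$. Then $a\le 0.8440935944$.
   Context: The diameter of a bounded point set is the supremum of the distances between pairs of its points. Congruent means isometric (translations, rotations and reflections are allowed). A covering for a collection of point sets is a set that contains a subset congruent to each point set in the collection. The minimum is known to exist (equivalently, the claim concerns the infimum of areas of convex coverings). *)

theory Defs
  imports "HOL-Analysis.Analysis"
begin

text \<open>Congruence by an isometry of the whole plane (translations, rotations, reflections).
  Distance-preserving self-maps of a Euclidean plane are automatically bijective.\<close>

definition congruent_sets :: "(real ^ 2) set \<Rightarrow> (real ^ 2) set \<Rightarrow> bool" where
  "congruent_sets S T \<longleftrightarrow>
     (\<exists>f :: real ^ 2 \<Rightarrow> real ^ 2. (\<forall>x y. dist (f x) (f y) = dist x y) \<and> f ` S = T)"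

definition covering_for :: "(real ^ 2) set set \<Rightarrow> (real ^ 2) set \<Rightarrow> bool" where
  "covering_for F C \<longleftrightarrow> (\<forall>S\<in>F. \<exists>T. T \<subseteq> C \<and> congruent_sets S T)"

text \<open>Boundedness is needed explicitly: \<^const>\<open>diameter\<close> is a real-valued supremum and is
  meaningless on unbounded sets.\<close>

definition unit_diameter_sets :: "(real ^ 2) set set" where
  "unit_diameter_sets = {S. bounded S \<and> diameter S = 1}"

text \<open>The area is taken in \<^typ>\<open>ennreal\<close>, so that unbounded convex coverings get area
  \<open>\<infinity>\<close> (the real-valued measure would give them 0). Every convex set in the plane is Lebesgue
  measurable, so no measurability condition is required. The least area is expressed as an
  infimum; it equals the minimum because the minimum is attained.\<close>

definition min_convex_covering_area :: ennreal where
  "min_convex_covering_area =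
     (INF C \<in> {C. convex C \<and> covering_for unit_diameter_sets C}. emeasure lebesgue C)"

end

(* Pal's hexagon with slanted cuts.  A set of diameter at most 1 extends to a body K of constant width 1, and K has a
   circumscribed regular hexagon of unit width at the angle t whenever Pal K t = 0, where Pal K is continuous and
   antiperiodic with antiperiod pi / 3.  Slightly slanted lines cut off two corners of the hexagon: by constant width, of two
   opposite cuts at least one misses K, so after a rotation by a multiple of pi / 3 the cuts at two suitable corners
   do.  A third corner can be truncated by unit circles around contact points and by one more line.  If K violates
   this last line in every admissible position, mirror images included, then its contact points are so restricted
   that Pal K has the same strict sign at both angles t - tilt and t + tilt, the sign depending on the parity of the rotation.
   Zeros of opposite sign are shown to be at least tilt apart, and this contradicts the antiperiodicity of Pal K. *)

theory Submission
  imports Defs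
begin

section \<open>Completion to constant width\<close>

text \<open>One hexagon alone cannot exclude a violation of the last line, so the angle of the
  hexagon must vary. A violating point lies in a thin lens bounded by that line and by unit circles
  about two contact points. That the lens is nonempty is a linear inequality between the contact
  offsets, and all later estimates feed on it. Such a point also raises the support function in the
  tilted direction, and the two other supports in \<open>Pal\<close> cannot fall far enough to
  compensate; this is the source of the signs at distance \<open>tilt\<close> from a zero. Each zero
  gets the parity of its rotation as a label. From a zero of one label to the next zero of the
  other, \<open>Pal\<close> is positive \<open>tilt\<close> after the first and negative
  \<open>tilt\<close> before the second, with no zero in between; the separation by
  \<open>tilt\<close> keeps both test points inside this interval. The angles enter the estimates
  through their cosine and sine as real variables \<open>c\<close>, \<open>s\<close>, and
  \<open>sqrt 3\<close> is enclosed between rationals, so that linear arithmetic can finish.\<close>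

definition unit_width :: "complex set \<Rightarrow> bool" where
  "unit_width K \<longleftrightarrow> (\<forall>x\<in>K. \<forall>y\<in>K. dist x y \<le> 1) \<and> (\<forall>t. \<exists>q\<in>K. q + cis t \<in> K)"

lemma inner_cis: "x \<bullet> cis t = Re x * cos t + Im x * sin t"
  by (simp add: inner_complex_def)

lemma norm_diff_sq: "(norm (x - y))\<^sup>2 = (norm x)\<^sup>2 - 2 * (x \<bullet> y) + (norm (y::'a::real_inner))\<^sup>2"
  by (simp add: power2_norm_eq_inner inner_diff_left inner_diff_right inner_commute)

text \<open>A step along \<open>- v\<close> brings all farthest points nearer, by compactness with a
  uniform margin \<open>e\<close>. The margin pays for a small component along \<open>u\<close>, and
  points that stay away from distance 1 tolerate any short step.\<close>

lemma farthest_points_one_sided_escape: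
  fixes u v p :: complex
  assumes K: "compact K" "p \<in> K" and le: "\<And>y. y \<in> K \<Longrightarrow> norm (p - y) \<le> 1"
    and u: "norm u = 1" and uv: "u \<bullet> v = 0"
    and side: "\<And>y. y \<in> K \<Longrightarrow> norm (p - y) = 1 \<Longrightarrow> (p - y) \<bullet> v > 0"
  obtains z where "z \<bullet> u > p \<bullet> u" "\<And>y. y \<in> K \<Longrightarrow> norm (z - y) \<le> 1"
proof -
  define D where "D = K \<inter> {y. norm (p - y) = 1}"
  have clD: "closed {y. norm (p - y) = 1}"
    by (intro closed_Collect_eq continuous_intros)
  have D: "compact D"
    using compact_Int_closed[OF K(1) clD] by (simp add: D_def)
  obtain e where e: "e > 0" "\<And>y. y \<in> D \<Longrightarrow> (p - y) \<bullet> v \<ge> e"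
  proof (cases "D = {}")
    case True
    show ?thesis by (rule that[of 1]) (simp_all add: True)
  next
    case False
    have "continuous_on D (\<lambda>y. (p - y) \<bullet> v)" by (intro continuous_intros)
    from continuous_attains_inf[OF D False this] obtain y0 where "y0 \<in> D" "\<forall>y\<in>D. (p - y0) \<bullet> v \<le> (p - y) \<bullet> v"
      by auto
    with side show ?thesis by (intro that[of "(p - y0) \<bullet> v"]) (auto simp: D_def)
  qed
  define w where "w = (e/2) *\<^sub>R u - v"
  have wD: "(p - y) \<bullet> w \<le> - e / 2" if "y \<in> D" for y
  proof -
    have "(p - y) \<bullet> u \<le> norm (p - y) * norm u" by (rule norm_cauchy_schwarz)
    also have "\<dots> = 1" using that u by (simp add: D_def)
    finally have "(e/2) * ((p - y) \<bullet> u) \<le> e/2" using e(1) by simp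
    then show ?thesis using e(2)[OF that] by (simp add: w_def inner_diff_right)
  qed
  define D' where "D' = K \<inter> {y. (p - y) \<bullet> w \<ge> - e / 4}"
  have clD': "closed {y. (p - y) \<bullet> w \<ge> - e / 4}"
    by (intro closed_Collect_le continuous_intros)
  have D': "compact D'"
    using compact_Int_closed[OF K(1) clD'] by (simp add: D'_def)
  obtain m where m: "m < 1" "\<And>y. y \<in> D' \<Longrightarrow> norm (p - y) \<le> m"
  proof (cases "D' = {}")
    case True
    show ?thesis by (rule that[of 0]) (simp_all add: True)
  next
    case False
    have "continuous_on D' (\<lambda>y. norm (p - y))" by (intro continuous_intros)
    from continuous_attains_sup[OF D' False this] obtain y0
      where y0: "y0 \<in> D'" "\<forall>y\<in>D'. norm (p - y) \<le> norm (p - y0)" by auto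
    have "norm (p - y0) \<noteq> 1"
    proof
      assume "norm (p - y0) = 1"
      with y0(1) have "y0 \<in> D" by (simp add: D_def D'_def)
      with wD[OF this] y0(1) e(1) show False by (simp add: D'_def)
    qed
    with le[of y0] y0 show ?thesis by (intro that[of "norm (p - y0)"]) (auto simp: D'_def)
  qed
  define W where "W = norm w + 1"
  have W: "W \<ge> 1" "norm w \<le> W" by (auto simp: W_def)
  \<comment> \<open>The first bound keeps the points of \<open>D'\<close> within 1 by the triangle
    inequality. For the other points the second lets the linear term, at most
    \<open>- s * e / 2\<close>, absorb the quadratic term, at most
    \<open>s * (s * W\<^sup>2)\<close>.\<close>
  define s where "s = min ((1 - m) / W) (e / (2 * W\<^sup>2))"
  have s0: "s > 0" using m(1) e(1) W by (simp add: s_def)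
  have s1: "s * W \<le> 1 - m"
  proof -
    have "s * W \<le> (1 - m) / W * W" using W by (intro mult_right_mono) (auto simp: s_def)
    then show ?thesis using W by simp
  qed
  have s2: "s * W\<^sup>2 \<le> e / 2"
  proof -
    have "s * W\<^sup>2 \<le> e / (2 * W\<^sup>2) * W\<^sup>2" using W by (intro mult_right_mono) (auto simp: s_def)
    then show ?thesis using W by simp
  qed
  show ?thesis
  proof (rule that[of "p + s *\<^sub>R w"])
    have "w \<bullet> u = e / 2" using u uv by (simp add: w_def inner_diff_left inner_diff_right inner_commute norm_eq_1)
    then show "(p + s *\<^sub>R w) \<bullet> u > p \<bullet> u" using s0 e(1) by (simp add: inner_add_left)
  next
    fix y assume y: "y \<in> K"
    show "norm (p + s *\<^sub>R w - y) \<le> 1"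
    proof (cases "y \<in> D'")
      case True
      have "norm (p + s *\<^sub>R w - y) \<le> norm (p - y) + norm (s *\<^sub>R w)"
        by (metis add_diff_eq diff_add_eq norm_triangle_ineq)
      also have "\<dots> \<le> m + s * W"
        using m(2)[OF True] s0 W by (intro add_mono) (auto intro!: mult_left_mono)
      finally show ?thesis using s1 by simp
    next
      case False
      then have neg: "(p - y) \<bullet> w < - e / 4" using y by (simp add: D'_def)
      have "(norm (p + s *\<^sub>R w - y))\<^sup>2 = (norm (p - y))\<^sup>2 + 2 * s * ((p - y) \<bullet> w) + s * (s * (norm w)\<^sup>2)"
        using norm_diff_sq[of "p - y" "- s *\<^sub>R w"]
        by (simp add: algebra_simps power2_eq_square)
      also have "\<dots> \<le> 1 + 2 * s * (- e / 4) + s * (s * W\<^sup>2)"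
        using le[OF y] neg s0 W
        by (intro add_mono mult_left_mono power_mono) (auto simp: power_le_one)
      also have "\<dots> \<le> 1 + 2 * s * (- e / 4) + s * (e / 2)"
        using s2 s0 by simp
      also have "\<dots> = 1" by simp
      finally have "(norm (p + s *\<^sub>R w - y))\<^sup>2 \<le> 1" .
      then show ?thesis by (simp add: abs_square_le_1)
    qed
  qed
qed

text \<open>A maximal set of diameter at most 1 is the intersection of the unit discs about its
  points. Its extreme point \<open>p\<close> in a direction \<open>u\<close> cannot be moved further
  outward, so there are points at distance 1 from \<open>p\<close> weakly on either side of the line
  through \<open>p\<close> along \<open>u\<close>. Together these force \<open>p - u\<close> within
  1 of the whole set, hence into it.\<close>

lemma unit_width_completion:
  assumes S: "\<And>x y. x \<in> S \<Longrightarrow> y \<in> S \<Longrightarrow> dist x y \<le> 1"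
  obtains K where "S \<subseteq> K" "unit_width K"
proof -
  define A where "A = {K::complex set. S \<subseteq> K \<and> (\<forall>x\<in>K. \<forall>y\<in>K. dist x y \<le> 1)}"
  have "\<exists>M\<in>A. \<forall>X\<in>A. M \<subseteq> X \<longrightarrow> X = M"
  proof (rule subset_Zorn_nonempty)
    show "A \<noteq> {}" using S by (auto simp: A_def)
    fix C assume C: "C \<noteq> {}" "subset.chain A C"
    have "dist x y \<le> 1" if "X \<in> C" "Y \<in> C" "x \<in> X" "y \<in> Y" for X Y x y
    proof -
      from C(2) that have "X \<subseteq> Y \<or> Y \<subseteq> X" "X \<in> A" "Y \<in> A"
        by (auto simp: subset_chain_def)
      with that show ?thesis unfolding A_def by blast
    qed
    moreover have "S \<subseteq> \<Union>C"
    proof -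
      obtain X where "X \<in> C" using C(1) by blast
      moreover from this C(2) have "S \<subseteq> X" by (auto simp: subset_chain_def A_def)
      ultimately show ?thesis by blast
    qed
    ultimately show "\<Union>C \<in> A" unfolding A_def by blast
  qed
  then obtain K where K: "K \<in> A" and max: "\<And>X. X \<in> A \<Longrightarrow> K \<subseteq> X \<Longrightarrow> X = K" by blast
  have d1: "dist x y \<le> 1" if "x \<in> K" "y \<in> K" for x y using K that by (auto simp: A_def)
  have full: "z \<in> K" if "\<And>x. x \<in> K \<Longrightarrow> dist z x \<le> 1" for z
  proof -
    have "insert z K \<in> A" using K that by (auto simp: A_def dist_commute)
    from max[OF this] show ?thesis by auto
  qed
  have ne: "K \<noteq> {}" using full[of 0] by auto
  have Keq: "K = (\<Inter>x\<in>K. cball x 1)" using full d1 by (auto simp: dist_commute)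
  have "closed (\<Inter>x\<in>K. cball x (1::real))" by auto
  then have "closed K" using Keq by simp
  moreover from ne obtain x0 where "x0 \<in> K" by auto
  then have "K \<subseteq> cball x0 1" using d1 by auto
  then have "bounded K" using bounded_cball bounded_subset by blast
  ultimately have cpt: "compact K" by (simp add: compact_eq_bounded_closed)
  have "\<exists>q\<in>K. q + cis t \<in> K" for t
  proof -
    define u where "u = cis t"
    define v where "v = cis (t + pi/2)"
    have uv: "norm u = 1" "norm v = 1" "u \<bullet> v = 0"
      by (simp_all add: u_def v_def inner_complex_def cos_add sin_add)
    have "continuous_on K (\<lambda>x. x \<bullet> u)" by (intro continuous_intros)
    from continuous_attains_sup[OF cpt ne this] obtain p
      where p: "p \<in> K" "\<And>x. x \<in> K \<Longrightarrow> x \<bullet> u \<le> p \<bullet> u" by auto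
    have le: "norm (p - y) \<le> 1" if "y \<in> K" for y using d1[OF p(1) that] by (simp add: dist_norm)
    have no_escape: False if "z \<bullet> u > p \<bullet> u" "\<And>y. y \<in> K \<Longrightarrow> norm (z - y) \<le> 1" for z
      using full[of z] p(2)[of z] that by (auto simp: dist_norm)
    obtain y1 where y1: "y1 \<in> K" "norm (p - y1) = 1" "(p - y1) \<bullet> v \<ge> 0"
    proof (rule ccontr)
      assume "\<not> thesis"
      then have "\<And>y. y \<in> K \<Longrightarrow> norm (p - y) = 1 \<Longrightarrow> (p - y) \<bullet> (- v) > 0"
        using that by force
      moreover have "u \<bullet> (- v) = 0" using uv by simp
      ultimately obtain z where "z \<bullet> u > p \<bullet> u" "\<And>y. y \<in> K \<Longrightarrow> norm (z - y) \<le> 1"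
        using farthest_points_one_sided_escape[OF cpt p(1) le uv(1)] by blast
      then show False by (rule no_escape)
    qed
    obtain y2 where y2: "y2 \<in> K" "norm (p - y2) = 1" "(p - y2) \<bullet> v \<le> 0"
    proof (rule ccontr)
      assume "\<not> thesis"
      then have "\<And>y. y \<in> K \<Longrightarrow> norm (p - y) = 1 \<Longrightarrow> (p - y) \<bullet> v > 0"
        using that by force
      then obtain z where "z \<bullet> u > p \<bullet> u" "\<And>y. y \<in> K \<Longrightarrow> norm (z - y) \<le> 1"
        using farthest_points_one_sided_escape[OF cpt p(1) le uv(1) uv(3)] by blast
      then show False by (rule no_escape)
    qed
    \<comment> \<open>Equivalent to \<open>p - u\<close> being within 1 of \<open>x\<close>. It
      follows from the distance bound between \<open>x\<close> and a farthest point \<open>y\<close>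
      on the other side of \<open>p\<close>: in the basis \<open>u\<close>, \<open>v\<close> the
      second components of \<open>p - x\<close> and \<open>p - y\<close> then contribute nothing
      positive.\<close>
    have key: "(norm (p - x))\<^sup>2 \<le> 2 * ((p - x) \<bullet> u)" if x: "x \<in> K" for x
    proof -
      define a where "a = (p - x) \<bullet> u"
      define b where "b = (p - x) \<bullet> v"
      have a0: "a \<ge> 0" using p(2)[OF x] by (simp add: a_def inner_diff_left)
      have bd: "(norm (p - x))\<^sup>2 \<le> 2 * a"
        if y: "y \<in> K" "norm (p - y) = 1" "b * ((p - y) \<bullet> v) \<le> 0" for y
      proof -
        have "(norm ((p - x) - (p - y)))\<^sup>2 \<le> 1"
          using d1[OF x y(1)] by (simp add: dist_norm norm_minus_commute power_le_one)
        then have "(norm (p - x))\<^sup>2 \<le> 2 * ((p - x) \<bullet> (p - y))"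
          unfolding norm_diff_sq[of "p - x" "p - y"] y(2) by simp
        also have "(p - x) \<bullet> (p - y) = a * ((p - y) \<bullet> u) + b * ((p - y) \<bullet> v)"
        proof -
          have 1: "X * X' + Y * Y' = (X * c1 + Y * s1) * (X' * c1 + Y' * s1) + (Y * c1 - X * s1) * (Y' * c1 - X' * s1)"
            if "c1 * c1 + s1 * s1 = 1" for X Y X' Y' c1 s1 :: real
          proof -
            have "(X * c1 + Y * s1) * (X' * c1 + Y' * s1) + (Y * c1 - X * s1) * (Y' * c1 - X' * s1)
                = (X * X' + Y * Y') * (c1 * c1 + s1 * s1)" by (simp add: algebra_simps)
            with that show ?thesis by simp
          qed
          have "cos t * cos t + sin t * sin t = 1" by (metis power2_eq_square sin_cos_squared_add2)
          from 1[OF this, of "Re (p - x)" "Re (p - y)" "Im (p - x)" "Im (p - y)"] show ?thesis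
            by (simp add: a_def b_def u_def v_def inner_complex_def cos_add sin_add algebra_simps)
        qed
        also have "a * ((p - y) \<bullet> u) \<le> a * 1"
          using norm_cauchy_schwarz[of "p - y" u] y(2) uv(1) a0 by (intro mult_left_mono) auto
        finally show ?thesis using y(3) by simp
      qed
      show ?thesis
      proof (cases "b \<ge> 0")
        case True
        then show ?thesis using bd[OF y2(1,2)] y2(3) unfolding a_def by (simp add: mult_nonneg_nonpos)
      next
        case False
        then show ?thesis using bd[OF y1(1,2)] y1(3) unfolding a_def by (simp add: mult_nonpos_nonneg)
      qed
    qed
    have "p - u \<in> K"
    proof (rule full)
      fix x assume x: "x \<in> K"
      have "(norm ((p - x) - u))\<^sup>2 \<le> 1"
        unfolding norm_diff_sq[of "p - x" u] using key[OF x] uv(1) by simp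
      then have "norm ((p - x) - u) \<le> 1" by (simp add: abs_square_le_1)
      then show "dist (p - u) x \<le> 1" by (simp add: dist_norm algebra_simps)
    qed
    with p(1) show ?thesis by (intro bexI[of _ "p - u"]) (auto simp: u_def)
  qed
  then have "unit_width K" using d1 by (auto simp: unit_width_def)
  moreover have "S \<subseteq> K" using K by (simp add: A_def)
  ultimately show ?thesis using that by blast
qed

text \<open>Take the first point \<open>n\<close> of \<open>N\<close> after some point of
  \<open>P\<close>, and the last point \<open>p\<close> of \<open>P\<close> before \<open>n\<close>.
  Between them \<open>F\<close> has no zero, yet it is positive at \<open>p + e\<close> and negative
  at \<open>n - e\<close>. The gap places both points strictly inside the interval, and it also
  makes \<open>P\<close> and \<open>N\<close> closed within the zero set, so that these extreme
  points exist.\<close>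

lemma antiperiodic_root_sign_contradiction:
  fixes F :: "real \<Rightarrow> real" and P N :: "real set"
  assumes cont: "continuous_on UNIV F" and a: "a > 0" and e: "e > 0"
    and anti: "\<And>t. F (t + a) = - F t"
    and roots: "\<And>t. F t = 0 \<longleftrightarrow> t \<in> P \<or> t \<in> N"
    and shift: "\<And>t. t \<in> P \<Longrightarrow> t + a \<in> N" "\<And>t. t \<in> N \<Longrightarrow> t + a \<in> P"
    and P1: "\<And>t. t \<in> P \<Longrightarrow> F (t + e) > 0" and N1: "\<And>t. t \<in> N \<Longrightarrow> F (t - e) < 0"
    and gap: "\<And>p n. p \<in> P \<Longrightarrow> n \<in> N \<Longrightarrow> \<bar>p - n\<bar> \<ge> e"
  shows False
proof -
  have contS: "continuous_on S F" for S using cont continuous_on_subset by blast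
  have cR: "closed {t. F t = 0}" by (intro closed_Collect_eq cont continuous_intros)
  have far: "closed (\<Inter>p\<in>X. {t. \<bar>p - t\<bar> \<ge> e})" for X :: "real set"
    by (intro closed_INT ballI closed_Collect_le continuous_intros)
  have "N = {t. F t = 0} \<inter> (\<Inter>p\<in>P. {t. \<bar>p - t\<bar> \<ge> e})"
    using roots gap e by force
  then have cN: "closed N" using closed_Int[OF cR far[of P]] by simp
  have "P = {t. F t = 0} \<inter> (\<Inter>p\<in>N. {t. \<bar>p - t\<bar> \<ge> e})"
    using roots gap e by (force simp: abs_minus_commute)
  then have cP: "closed P" using closed_Int[OF cR far[of N]] by simp
  have ivt: "\<exists>t. x \<le> t \<and> t \<le> y \<and> F t = 0" if "x \<le> y" "F x * F y \<le> 0" for x y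
  proof (cases "F x \<le> 0")
    case True
    show ?thesis
    proof (cases "F y \<ge> 0")
      case True
      show ?thesis using IVT'[of F x 0 y, OF \<open>F x \<le> 0\<close> True that(1) contS] by blast
    next
      case False
      with that(2) True have "F x = 0" by (metis linorder_not_le mult_neg_neg order_le_less)
      with that(1) show ?thesis by blast
    qed
  next
    case False
    then have "F y \<le> 0" using that(2) by (simp add: mult_le_0_iff)
    then show ?thesis using IVT2'[of F y 0 x, OF _ _ that(1) contS] False by force
  qed
  have "F 0 * F (0 + a) \<le> 0" unfolding anti by simp
  then obtain t0 where "F t0 = 0" using ivt[of 0 "0 + a"] a by force
  then obtain p0 where p0: "p0 \<in> P" using roots shift by blast
  have cpN: "compact ({p0..p0+a} \<inter> N)" using cN by (intro compact_Int_closed) auto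
  have "p0 + a \<in> {p0..p0+a} \<inter> N" using shift(1)[OF p0] a by simp
  then have neN: "{p0..p0+a} \<inter> N \<noteq> {}" by blast
  from compact_attains_inf[OF cpN neN] obtain n where
    n: "n \<in> N" "p0 \<le> n" "n \<le> p0 + a" and nmin: "\<And>t. t \<in> N \<Longrightarrow> p0 \<le> t \<Longrightarrow> t \<le> p0 + a \<Longrightarrow> n \<le> t"
    by auto
  have cpP: "compact ({p0..n} \<inter> P)" using cP by (intro compact_Int_closed) auto
  have "p0 \<in> {p0..n} \<inter> P" using p0 n by simp
  then have neP: "{p0..n} \<inter> P \<noteq> {}" by blast
  from compact_attains_sup[OF cpP neP] obtain p where
    p: "p \<in> P" "p0 \<le> p" "p \<le> n" and pmax: "\<And>t. t \<in> P \<Longrightarrow> p0 \<le> t \<Longrightarrow> t \<le> n \<Longrightarrow> t \<le> p"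
    by auto
  have no_root: "F t \<noteq> 0" if "p < t" "t < n" for t
    using roots[of t] pmax[of t] nmin[of t] that p n by force
  have ge: "n - p \<ge> e" using gap[OF p(1) n(1)] p by simp
  have "F n = 0" "F p = 0" using roots n p by blast+
  then have lt: "p + e < n" "p < n - e" using P1[OF p(1)] N1[OF n(1)] ge
    by (smt (verit))+
  have "F (p + e) * F (n - e) \<le> 0" "F (n - e) * F (p + e) \<le> 0"
    using P1[OF p(1)] N1[OF n(1)] by (simp_all add: mult_le_0_iff)
  then have "\<exists>t. (p + e \<le> t \<and> t \<le> n - e \<or> n - e \<le> t \<and> t \<le> p + e) \<and> F t = 0"
    using ivt[of "p + e" "n - e"] ivt[of "n - e" "p + e"] by (meson linear)
  then show False using no_root lt e by (smt (verit))
qed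

section \<open>Bodies touching all sides of a hexagon\<close>

text \<open>Makes the curvature of the cosine available as a polynomial relation between cosine and
  sine, the form required by \<open>opposite_label_1\<close>.\<close>

lemma cos_le_quadratic: "cos (x::real) \<le> 1 - (sin x)\<^sup>2 / 2"
proof -
  have "(1 - cos x)\<^sup>2 \<ge> 0" by simp
  then have "2 * cos x \<le> 1 + (cos x)\<^sup>2" by (simp add: power2_eq_square algebra_simps)
  then show ?thesis by (simp add: sin_squared_eq field_simps)
qed

lemma sqrt3_bounds: "(17320508075 / 10000000000) < sqrt (3::real)" "sqrt (3::real) < (17320508076 / 10000000000)"
  by (rule real_less_rsqrt real_less_lsqrt; simp add: power2_eq_square)+

text \<open>The regular hexagon of width 1 about 0 has corners \<open>A, B, \<dots>, F\<close>, counterclockwise with \<open>A\<close> at the top;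
  \<open>K\<close> touches each side in one point, opposite contact points have distance 1, and \<open>\<epsilon>, \<phi>, \<gamma>\<close> are the
  offsets of these three chords from 0.\<close>

locale hexagonal_body =
  fixes K :: "complex set" and \<epsilon> \<phi> \<gamma> :: real
  assumes dist_le: "\<And>x y. x \<in> K \<Longrightarrow> y \<in> K \<Longrightarrow> dist x y \<le> 1"
    and EF: "Complex (1/2) \<epsilon> \<in> K" and BC: "Complex (-1/2) \<epsilon> \<in> K"
    and DE: "Complex (1/4 + \<phi> * sqrt 3 / 2) (- sqrt 3 / 4 + \<phi> / 2) \<in> K"
    and AB: "Complex (- 1/4 + \<phi> * sqrt 3 / 2) (sqrt 3 / 4 + \<phi> / 2) \<in> K"
    and CD: "Complex (- 1/4 + \<gamma> * sqrt 3 / 2) (- sqrt 3 / 4 - \<gamma> / 2) \<in> K"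
    and FA: "Complex (1/4 + \<gamma> * sqrt 3 / 2) (sqrt 3 / 4 - \<gamma> / 2) \<in> K"
begin

text \<open>The unit disc about \<open>p\<close> in the form of its tangent half-planes: for a fixed
  direction the condition is linear in the coordinates of both points.\<close>

lemma disc:
  assumes "p \<in> K" "z \<in> K" "a * a + b * b = 1"
  shows "(Re z - Re p) * a + (Im z - Im p) * b \<le> 1"
proof -
  have "(z - p) \<bullet> Complex a b \<le> norm (z - p) * norm (Complex a b)" by (rule norm_cauchy_schwarz)
  also have "\<dots> \<le> 1" using dist_le[OF assms(2,1)] assms(3)
    by (simp add: dist_norm cmod_def power2_eq_square)
  finally show ?thesis by (simp add: inner_complex_def)
qed

lemma disc_cis: "p \<in> K \<Longrightarrow> z \<in> K \<Longrightarrow> (Re z - Re p) * cos t + (Im z - Im p) * sin t \<le> 1"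
  by (rule disc) (metis power2_eq_square sin_cos_squared_add2)+

lemma in_hexagon:
  assumes "z \<in> K"
  shows "Re z \<le> 1/2" "- Re z \<le> 1/2"
    "Re z + sqrt 3 * Im z \<le> 1" "- Re z + sqrt 3 * Im z \<le> 1"
    "- Re z - sqrt 3 * Im z \<le> 1" "Re z - sqrt 3 * Im z \<le> 1"
proof -
  have s: "sqrt 3 / 2 * (sqrt 3 / 2) = (3/4 :: real)" by (simp add: field_simps)
  show "Re z \<le> 1/2" using disc[OF BC assms, of 1 0] by simp
  show "- Re z \<le> 1/2" using disc[OF EF assms, of "-1" 0] by simp
  show "Re z + sqrt 3 * Im z \<le> 1" using disc[OF CD assms, of "1/2" "sqrt 3 / 2"] s by (simp add: algebra_simps)
  show "- Re z + sqrt 3 * Im z \<le> 1" using disc[OF DE assms, of "-1/2" "sqrt 3 / 2"] s by (simp add: algebra_simps)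
  show "- Re z - sqrt 3 * Im z \<le> 1" using disc[OF FA assms, of "-1/2" "- sqrt 3 / 2"] s by (simp add: field_simps)
  show "Re z - sqrt 3 * Im z \<le> 1" using disc[OF AB assms, of "1/2" "- sqrt 3 / 2"] s by (simp add: algebra_simps)
qed

text \<open>The extreme point in direction \<open>- pi/3 + \<rho>\<close> is cut out by the side \<open>DE\<close> and by the disc
  about the contact point on \<open>BC\<close>, whose boundary passes close to the direction \<open>- pi/6\<close>.\<close>

lemma support_DE_side:
  assumes z: "z \<in> K" and cs: "0 \<le> s" "sqrt 3 * s \<le> c"
  shows "Re z * (c / 2 + sqrt 3 / 2 * s) + Im z * (s / 2 - sqrt 3 / 2 * c)
    \<le> c / 2 + (2 - sqrt 3 - \<epsilon>) * s"
proof -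
  have "(Re z - (-1/2)) * (sqrt 3 / 2) + (Im z - \<epsilon>) * (- 1/2) \<le> 1"
    using disc[OF BC z, of "sqrt 3 / 2" "- 1/2"] by simp
  then have 1: "(2 * s) * ((Re z - (-1/2)) * (sqrt 3 / 2) + (Im z - \<epsilon>) * (- 1/2)) \<le> (2 * s) * 1"
    using cs(1) by (intro mult_left_mono) auto
  have 2: "(c - sqrt 3 * s) * (Re z - sqrt 3 * Im z) \<le> (c - sqrt 3 * s) * 1"
    using cs in_hexagon(6)[OF z] by (intro mult_left_mono) auto
  have 3: "sqrt 3 * s * (sqrt 3 * Im z) = 3 * (s * Im z)" by simp
  show ?thesis using 1 2 3 by (simp add: field_simps)
qed

text \<open>The mirror image of \<open>support_DE_side\<close>. The direction is the combination of
  the normal of \<open>BC\<close> and the direction of the corner B with weights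
  \<open>c - sqrt 3 * s\<close> and \<open>2 * s\<close>; the hypotheses on \<open>c\<close> and
  \<open>s\<close> say that both weights are nonnegative.\<close>

lemma support_BC_side:
  assumes z: "z \<in> K" and cs: "0 \<le> s" "sqrt 3 * s \<le> c"
  shows "- Re z * c + Im z * s \<le> c / 2 + (2 - sqrt 3 - \<phi>) * s"
proof -
  have "(Re z - (1/4 + \<phi> * sqrt 3 / 2)) * (- sqrt 3 / 2) + (Im z - (- sqrt 3 / 4 + \<phi> / 2)) * (1/2) \<le> 1"
    using disc[OF DE z, of "- sqrt 3 / 2" "1/2"] by simp
  then have 1: "(2 * s) * ((Re z - (1/4 + \<phi> * sqrt 3 / 2)) * (- sqrt 3 / 2) + (Im z - (- sqrt 3 / 4 + \<phi> / 2)) * (1/2)) \<le> (2 * s) * 1"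
    using cs(1) by (intro mult_left_mono) auto
  have 2: "(c - sqrt 3 * s) * (- Re z) \<le> (c - sqrt 3 * s) * (1/2)"
    using cs in_hexagon(2)[OF z] by (intro mult_left_mono) auto
  have 3: "sqrt 3 * (sqrt 3 * (s * \<phi>)) = 3 * (s * \<phi>)" by simp
  show ?thesis using 1 2 3 by (simp add: field_simps)
qed

end

text \<open>Numerically optimised angles. The tangents of their halves are rational, which makes their sines and cosines
  rational. The slanted cuts deviate by \<open>slant\<close> from the bisecting directions of the hexagon, and the extra line
  at the third corner by \<open>tilt\<close> from the side \<open>AB\<close>, at distance \<open>0.5223061\<close> from the centre.\<close>

definition tilt :: real where "tilt = 2 * arctan (139/2000)"
definition slant :: real where "slant = 2 * arctan (7/500)"

lemma cos_double_arctan: "cos (2 * arctan x) = (1 - x\<^sup>2) / (1 + x\<^sup>2)"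
  and sin_double_arctan: "sin (2 * arctan x) = 2 * x / (1 + x\<^sup>2)"
proof -
  have pos: "1 + x\<^sup>2 > 0" by (simp add: add_pos_nonneg)
  have c2: "(cos (arctan x))\<^sup>2 = 1 / (1 + x\<^sup>2)"
    using pos by (simp add: cos_arctan power_divide)
  have s: "sin (arctan x) = x * cos (arctan x)"
    by (simp add: cos_arctan sin_arctan)
  have "cos (2 * arctan x) = (1 - x\<^sup>2) * (cos (arctan x))\<^sup>2"
    unfolding cos_double s by (simp add: power_mult_distrib left_diff_distrib)
  then show "cos (2 * arctan x) = (1 - x\<^sup>2) / (1 + x\<^sup>2)" by (simp add: c2)
  have "sin (2 * arctan x) = 2 * x * (cos (arctan x))\<^sup>2"
    unfolding sin_double s by (simp add: power2_eq_square)
  then show "sin (2 * arctan x) = 2 * x / (1 + x\<^sup>2)" by (simp add: c2)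
qed

lemma cos_tilt: "cos tilt = 3980679 / 4019321" and sin_tilt: "sin tilt = 556000 / 4019321"
  by (simp_all add: tilt_def cos_double_arctan sin_double_arctan power2_eq_square)

lemma cos_slant: "cos slant = 249951 / 250049" and sin_slant: "sin slant = 7000 / 250049"
  by (simp_all add: slant_def cos_double_arctan sin_double_arctan power2_eq_square)

lemma tilt_pos: "tilt > 0" by (simp add: tilt_def)

text \<open>Replaces an irrational factor by a rational one at the cost of a constant, which turns
  products such as \<open>sqrt 3 * x\<close> into linear terms.\<close>

lemma mult_near:
  fixes a r x :: real
  assumes "\<bar>a - r\<bar> \<le> d" "\<bar>x\<bar> \<le> 1"
  shows "a * x \<le> r * x + d" "a * x \<ge> r * x - d"
proof -
  have "\<bar>(a - r) * x\<bar> \<le> d * 1" unfolding abs_mult using assms by (intro mult_mono) auto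
  then show "a * x \<le> r * x + d" "a * x \<ge> r * x - d" by (simp_all add: left_diff_distrib abs_le_iff)
qed

section \<open>Linear inequalities for the contact offsets\<close>

context hexagonal_body
begin

lemma offset_bounds: "\<bar>\<epsilon>\<bar> \<le> 1" "\<bar>\<phi>\<bar> \<le> 1" "\<bar>\<gamma>\<bar> \<le> 1"
proof -
  have *: "\<bar>x\<bar> \<le> 1" if "\<bar>x\<bar> * sqrt 3 \<le> 3/2" for x :: real
  proof (rule ccontr)
    assume "\<not> ?thesis"
    then have "\<bar>x\<bar> * sqrt 3 \<ge> 1 * sqrt 3" by (intro mult_right_mono) auto
    then show False using that sqrt3_bounds by linarith
  qed
  have "\<bar>\<epsilon> * sqrt 3\<bar> \<le> 3/2" using in_hexagon(3,6)[OF EF] by (simp add: mult.commute abs_le_iff)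
  then show "\<bar>\<epsilon>\<bar> \<le> 1" by (intro *) (simp add: abs_mult)
  have "\<bar>\<phi> * sqrt 3\<bar> \<le> 3/2" using in_hexagon(1,2)[OF DE] in_hexagon(1,2)[OF AB] by simp
  then show "\<bar>\<phi>\<bar> \<le> 1" by (intro *) (simp add: abs_mult)
  have "\<bar>\<gamma> * sqrt 3\<bar> \<le> 3/2" using in_hexagon(1,2)[OF CD] in_hexagon(1,2)[OF FA] by simp
  then show "\<bar>\<gamma>\<bar> \<le> 1" by (intro *) (simp add: abs_mult)
qed

text \<open>The two directions of the discs are approximately the normals at the corner of the lens
  for the extremal offsets; any choice would give a valid linear inequality.\<close>

lemma lens_offsets:
  assumes y: "y \<in> K" and gt: "Re y * cos tilt + Im y * sin tilt > (5223061 / 10000000)"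
  shows "(66999 / 1000000) * \<epsilon> + (39014 / 1000000) * \<gamma> \<ge> (82839 / 10000000)"
proof -
  have 1: "(Re y + 1/2) * (998631/1001369) + (Im y - \<epsilon>) * (74000/1001369) \<le> 1"
    using disc[OF BC y, of "998631/1001369" "74000/1001369"] by simp
  have 2: "(Re y - (- 1/4 + \<gamma> * sqrt 3 / 2)) * (272/353) + (Im y - (- sqrt 3 / 4 - \<gamma> / 2)) * (225/353) \<le> 1"
    using disc[OF CD y, of "272/353" "225/353"] by simp
  have 3: "sqrt 3 * \<gamma> \<le> (17320508 / 10000000) * \<gamma> + (1 / 100000000)"
    using mult_near(1)[of "sqrt 3" "(17320508 / 10000000)" "(1 / 100000000)" \<gamma>] offset_bounds sqrt3_bounds by (simp add: abs_le_iff)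
  show ?thesis
    using 1 2 3 gt[unfolded cos_tilt sin_tilt] sqrt3_bounds offset_bounds(1,3)
    unfolding mult.commute[of \<gamma>] abs_le_iff by argo
qed

text \<open>The left side is the lower bound for \<open>Pal\<close> at \<open>tilt\<close> that
  arises in \<open>bad_frame_Pal_pos\<close>, where the cosine terms cancel. The upper bound on
  \<epsilon> helps because \<open>lens_offsets\<close> gives \<epsilon> more weight than \<gamma>:
  it makes \<epsilon> + \<gamma> smallest when \<epsilon> is largest.\<close>

lemma lens_offsets_sum:
  assumes "y \<in> K" "Re y * cos tilt + Im y * sin tilt > 5223061/10000000" and e: "\<epsilon> \<le> 141506/1000000"
  shows "(5223061/10000000 - 1/2) + sin tilt * (\<epsilon> + \<gamma> - (2 - sqrt 3)) > 0"
proof -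
  have "\<epsilon> + \<gamma> \<ge> 11080/100000" using lens_offsets[OF assms(1,2)] e by linarith
  then have "\<epsilon> + \<gamma> - (2 - sqrt 3) \<ge> 11080/100000 - 2 + 17320508/10000000" using sqrt3_bounds by linarith
  then have "sin tilt * (\<epsilon> + \<gamma> - (2 - sqrt 3)) \<ge> sin tilt * (11080/100000 - 2 + 17320508/10000000)"
    by (intro mult_left_mono) (auto simp: sin_tilt)
  then show ?thesis unfolding sin_tilt by argo
qed

text \<open>Here \<open>(c, s)\<close> is the direction of a second regular circumscribed hexagon with centre \<open>o\<close>;
  the three hypotheses on \<open>o\<close> are consequences of the contact points of the first one.\<close>

lemma opposite_label_1:
  assumes lens: "66999/1000000 * \<epsilon> + 39014/1000000 * \<gamma> \<ge> 82839/10000000"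
      "66999/1000000 * \<phi> - 39014/1000000 * \<gamma> \<ge> 82839/10000000"
    and pm: "\<epsilon> \<le> 141506/1000000"
    and cs: "s \<ge> 0" "c \<le> 1 - s\<^sup>2 / 2" "sqrt 3 * (sin tilt * c - cos tilt * s) \<le> cos tilt * c + sin tilt * s"
      "sin tilt * c - cos tilt * s \<ge> 0"
    and f: "f0 + f1 + f2 = 0" "f1 \<ge> 1/2 - c/2 - (2 - sqrt 3 - \<epsilon>) * s" "f2 \<ge> c/2 + \<gamma> * s - 1/2"
    and z: "z \<in> K"
  shows "- Re z * (cos tilt * c + sin tilt * s) + Im z * (sin tilt * c - cos tilt * s)
      + ((cos tilt + sin tilt * sqrt 3 / 3) * f0 + (2 * sin tilt * sqrt 3 / 3) * f2) \<le> 5223061/10000000"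
proof -
  \<comment> \<open>The coordinates of a unit vector turned by \<open>tilt\<close> with respect to
    two normals of the second hexagon, as in \<open>tilt_combination\<close>.\<close>
  define a where "a = cos tilt + sin tilt * sqrt 3 / 3"
  define b where "b = 2 * sin tilt * sqrt 3 / 3"
  have ab: "\<bar>a - 107025185/100000000\<bar> \<le> 1/10000000" "\<bar>b - 15973183/100000000\<bar> \<le> 1/10000000"
    using sqrt3_bounds by (simp_all add: a_def b_def cos_tilt sin_tilt abs_le_iff)
  have a0: "a \<ge> 0" "b \<le> a" and b0: "b \<ge> 15973/100000" using ab by linarith+
  have g: "\<gamma> \<ge> -3069/100000" using lens(1) pm by linarith
  have phi: "\<phi> \<ge> 105/1000" using lens(2) g by linarith
  have 1: "- Re z * (cos tilt * c + sin tilt * s) + Im z * (sin tilt * c - cos tilt * s)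
      \<le> (cos tilt * c + sin tilt * s) / 2 + (2 - sqrt 3 - \<phi>) * (sin tilt * c - cos tilt * s)"
    by (rule support_BC_side[OF z cs(4,3)])
  have "(2 - sqrt 3 - \<phi>) * (sin tilt * c - cos tilt * s) \<le> (163/1000) * (sin tilt * c - cos tilt * s)"
    using phi sqrt3_bounds cs(4) by (intro mult_right_mono) auto
  note 1 = order_trans[OF 1 add_left_mono[OF this]]
  \<comment> \<open>Eliminating \<open>f0\<close> leaves \<open>f1\<close> and \<open>f2\<close>
    with nonpositive coefficients, so that their lower bounds apply.\<close>
  have f0: "f0 = - f1 - f2" using f(1) by simp
  have "a * f0 + b * f2 = - (a * f1) - (a - b) * f2" by (simp add: f0 algebra_simps)
  also have "\<dots> \<le> - (a * (1/2 - c/2 - (2 - sqrt 3 - \<epsilon>) * s)) - (a - b) * (c/2 + \<gamma> * s - 1/2)"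
    using f(2,3) a0 by (intro diff_mono le_imp_neg_le mult_left_mono) auto
  also have "\<dots> = - b * (1 - c) / 2 + (a * (2 - sqrt 3 - \<epsilon>) - (a - b) * \<gamma>) * s"
    by (simp add: algebra_simps diff_divide_distrib add_divide_distrib)
  also have "\<dots> \<le> - (15973/100000) * (1 - c) / 2 + (16330/100000) * s"
  proof (intro add_mono mult_right_mono)
    have "c \<le> 1" using cs(2) by (smt (verit) divide_nonneg_pos zero_le_power2)
    then have "(15973/100000) * (1 - c) \<le> b * (1 - c)" using b0 by (intro mult_right_mono) auto
    then show "- b * (1 - c) / 2 \<le> - (15973/100000) * (1 - c) / 2" by simp
    have "\<bar>2 - sqrt 3 - \<epsilon>\<bar> \<le> 1" using offset_bounds(1) lens(1) pm g sqrt3_bounds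
      using offset_bounds(3) by (simp add: abs_le_iff)
    then have "a * (2 - sqrt 3 - \<epsilon>) \<le> (107025185/100000000) * (2 - sqrt 3 - \<epsilon>) + 1/10000000"
      by (rule mult_near(1)[OF ab(1)])
    moreover have "(a - b) * \<gamma> \<ge> (91052002/100000000) * \<gamma> - 1/1000000"
    proof (rule mult_near(2))
      show "\<bar>a - b - 91052002/100000000\<bar> \<le> 1/1000000" using ab by linarith
    qed (rule offset_bounds)
    ultimately show "a * (2 - sqrt 3 - \<epsilon>) - (a - b) * \<gamma> \<le> 16330/100000"
      using lens(1) pm sqrt3_bounds by argo
  qed (rule cs)
  finally have 2: "a * f0 + b * f2 \<le> - (15973/100000) * (1 - c) / 2 + (16330/100000) * s" .
  \<comment> \<open>The tangent to the square at 0.119, which is close to the value of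
    \<open>s\<close> where the sum of the two preceding bounds is largest. It makes the quadratic
    bound on \<open>c\<close> linear in \<open>s\<close>.\<close>
  have "(s - 119/1000)\<^sup>2 \<ge> 0" by simp
  then have "s\<^sup>2 \<ge> 238/1000 * s - 14161/1000000" by (simp add: power2_eq_square algebra_simps)
  then show ?thesis using 1 2 cs(1,2) unfolding a_def[symmetric] b_def[symmetric]
    unfolding cos_tilt sin_tilt by argo
qed

text \<open>With \<open>c\<close> and \<open>s\<close> the cosine and sine of \<rho>, the direction
  \<open>\<rho> + 5 * pi / 3 - tilt\<close> lies between the normal of \<open>DE\<close> and the
  direction opposite to the extra line. Its unit vector times \<open>sin tilt\<close> combines these
  two with weights \<open>sin \<rho>\<close> and \<open>sin (tilt - \<rho>)\<close>. The side bounds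
  the first part; the unit disc about the violating point \<open>x\<close> of the first hexagon
  bounds the second, by 1 - 0.5223061.\<close>

lemma opposite_label_3:
  assumes phi: "\<phi> \<ge> 105/1000" and eps: "\<epsilon> \<le> 142/1000"
    and cs: "s \<ge> 0" "c \<le> 1" "c \<ge> cos tilt" "s \<le> sin tilt" "sin tilt * c - cos tilt * s \<ge> 0"
    and f: "f1 \<le> 1/2 - c/2 - \<phi> * s" "f0 \<le> 1/2 - c/2 + \<epsilon> * s"
    and x: "x \<in> K" "Re x * (sqrt 3 / 2 * sin tilt - cos tilt / 2) + Im x * (sqrt 3 / 2 * cos tilt + sin tilt / 2) > 5223061/10000000"
    and z: "z \<in> K"
  shows "s * (Re z / 2 - sqrt 3 / 2 * Im z)
      + (sin tilt * c - cos tilt * s) * (- Re z * (sqrt 3 / 2 * sin tilt - cos tilt / 2) - Im z * (sqrt 3 / 2 * cos tilt + sin tilt / 2))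
      + sin tilt * ((cos tilt + sin tilt * sqrt 3 / 3) * f1 + (2 * sin tilt * sqrt 3 / 3) * f0)
      \<le> sin tilt * (5223061/10000000)"
proof -
  define a where "a = cos tilt + sin tilt * sqrt 3 / 3"
  define b where "b = 2 * sin tilt * sqrt 3 / 3"
  have ab: "a \<ge> 1070/1000" "a \<le> 1071/1000" "b \<ge> 159/1000" "b \<le> 160/1000"
    using sqrt3_bounds by (simp_all add: a_def b_def cos_tilt sin_tilt)
  define p where "p = sqrt 3 / 2 * sin tilt - cos tilt / 2"
  define q where "q = sqrt 3 / 2 * cos tilt + sin tilt / 2"
  have "cos tilt * cos tilt + sin tilt * sin tilt = 1" by (metis power2_eq_square sin_cos_squared_add2)
  moreover have "(- (r/2 * S - C/2)) * (- (r/2 * S - C/2)) + (- (r/2 * C + S/2)) * (- (r/2 * C + S/2))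
      = (r * r / 4 + 1/4) * (C * C + S * S)" for r S C :: real
    by (simp add: field_simps)
  ultimately have pq: "(- p) * (- p) + (- q) * (- q) = 1"
    unfolding p_def q_def by simp
  have "(Re z - Re x) * (- p) + (Im z - Im x) * (- q) \<le> 1" by (rule disc[OF x(1) z pq])
  then have zx: "- Re z * p - Im z * q \<le> 4776939/10000000"
    using x(2) unfolding p_def[symmetric] q_def[symmetric] by (simp add: algebra_simps)
  have 1: "s * (Re z / 2 - sqrt 3 / 2 * Im z) \<le> s * (1/2)"
    using in_hexagon(6)[OF z] cs(1) by (intro mult_left_mono) auto
  have 2: "(sin tilt * c - cos tilt * s) * (- Re z * p - Im z * q) \<le> (sin tilt * c - cos tilt * s) * (4776939/10000000)"
    using zx cs(5) by (intro mult_left_mono) auto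
  have "f1 \<le> 1/2 - c/2 - 105/1000 * s" using f(1) mult_right_mono[OF phi cs(1)] by linarith
  then have "a * f1 \<le> a * (1/2 - c/2 - 105/1000 * s)" using ab by (intro mult_left_mono) auto
  also have "\<dots> \<le> (1071/1000) * (1/2 - c/2)"
  proof -
    have "a * (1/2 - c/2) \<le> (1071/1000) * (1/2 - c/2)" using ab cs(2) by (intro mult_right_mono) auto
    moreover have "0 \<le> a * (105/1000 * s)" using ab cs(1) by simp
    ultimately show ?thesis by (simp add: right_diff_distrib)
  qed
  finally have f1: "a * f1 \<le> (1071/1000) * (1/2 - c/2)" .
  have "f0 \<le> 1/2 - c/2 + 142/1000 * s" using f(2) mult_right_mono[OF eps cs(1)] by linarith
  then have "b * f0 \<le> b * (1/2 - c/2 + 142/1000 * s)" using ab by (intro mult_left_mono) auto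
  also have "\<dots> \<le> (160/1000) * (1/2 - c/2 + 142/1000 * s)"
    using ab cs(1,2) by (intro mult_right_mono) auto
  finally have f0: "b * f0 \<le> (160/1000) * (1/2 - c/2 + 142/1000 * s)" .
  have "sin tilt * (a * f1 + b * f0) \<le> sin tilt * ((1071/1000) * (1/2 - c/2) + (160/1000) * (1/2 - c/2 + 142/1000 * s))"
    using add_mono[OF f1 f0] by (intro mult_left_mono) (auto simp: sin_tilt)
  then show ?thesis using 1 2 cs unfolding a_def[symmetric] b_def[symmetric] p_def[symmetric] q_def[symmetric]
    unfolding cos_tilt sin_tilt by argo
qed

text \<open>Here the direction is \<open>\<rho> + tilt - pi / 3\<close>, so
  \<open>support_DE_side\<close> applies at the angle \<open>\<rho> + tilt\<close>. The values 0.105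
  and 0.031 are roundings of what \<open>bad_frame_offsets\<close> implies.\<close>

lemma opposite_label_5:
  assumes phi: "\<phi> \<ge> 105/1000" and eps: "\<epsilon> \<ge> 105/1000" and gam: "\<gamma> \<le> 31/1000"
    and cs: "s \<ge> 0" "c \<le> 1" "c \<ge> cos tilt" "s \<le> sin tilt"
    and f: "f1 \<le> 1/2 - c/2 - \<phi> * s" "f2 \<le> 1/2 - c/2 + \<gamma> * s"
    and z: "z \<in> K"
  shows "Re z * ((cos tilt * c - sin tilt * s) / 2 + sqrt 3 / 2 * (sin tilt * c + cos tilt * s))
      + Im z * ((sin tilt * c + cos tilt * s) / 2 - sqrt 3 / 2 * (cos tilt * c - sin tilt * s))
      + ((cos tilt + sin tilt * sqrt 3 / 3) * f1 + (2 * sin tilt * sqrt 3 / 3) * f2) \<le> 5223061/10000000"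
proof -
  define a where "a = cos tilt + sin tilt * sqrt 3 / 3"
  define b where "b = 2 * sin tilt * sqrt 3 / 3"
  have ab: "a \<ge> 1070/1000" "a \<le> 1071/1000" "b \<ge> 159/1000" "b \<le> 160/1000"
    using sqrt3_bounds by (simp_all add: a_def b_def cos_tilt sin_tilt)
  have c0: "c \<ge> 99/100" and s0: "s \<le> 139/1000" using cs(3,4) by (simp_all add: cos_tilt sin_tilt)
  have nn: "0 \<le> sin tilt * c + cos tilt * s" using c0 cs(1) by (simp add: cos_tilt sin_tilt)
  have sm: "sqrt 3 * (sin tilt * c + cos tilt * s) \<le> cos tilt * c - sin tilt * s"
  proof -
    have "sqrt 3 * (sin tilt * c + cos tilt * s) \<le> 2 * (sin tilt * c + cos tilt * s)"
      using sqrt3_bounds nn by (intro mult_right_mono) auto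
    then show ?thesis using c0 s0 cs unfolding cos_tilt sin_tilt by argo
  qed
  have 1: "Re z * ((cos tilt * c - sin tilt * s) / 2 + sqrt 3 / 2 * (sin tilt * c + cos tilt * s))
      + Im z * ((sin tilt * c + cos tilt * s) / 2 - sqrt 3 / 2 * (cos tilt * c - sin tilt * s))
    \<le> (cos tilt * c - sin tilt * s) / 2 + (2 - sqrt 3 - \<epsilon>) * (sin tilt * c + cos tilt * s)"
    by (rule support_DE_side[OF z nn sm])
  have "(2 - sqrt 3 - \<epsilon>) * (sin tilt * c + cos tilt * s) \<le> (163/1000) * (sin tilt * c + cos tilt * s)"
    using eps sqrt3_bounds nn by (intro mult_right_mono) auto
  note 1 = order_trans[OF 1 add_left_mono[OF this]]
  have "f1 \<le> 1/2 - c/2 - 105/1000 * s" using f(1) mult_right_mono[OF phi cs(1)] by linarith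
  then have "a * f1 \<le> a * (1/2 - c/2 - 105/1000 * s)" using ab by (intro mult_left_mono) auto
  also have "\<dots> \<le> (1071/1000) * (1/2 - c/2) - (1070/1000) * (105/1000 * s)"
  proof -
    have "a * (1/2 - c/2) \<le> (1071/1000) * (1/2 - c/2)" using ab cs(2) by (intro mult_right_mono) auto
    moreover have "(1070/1000) * (105/1000 * s) \<le> a * (105/1000 * s)" using ab cs(1) by (intro mult_right_mono) auto
    ultimately show ?thesis by (simp add: right_diff_distrib)
  qed
  finally have f1: "a * f1 \<le> (1071/1000) * (1/2 - c/2) - (1070/1000) * (105/1000 * s)" .
  have "f2 \<le> 1/2 - c/2 + 31/1000 * s" using f(2) mult_right_mono[OF gam cs(1)] by linarith
  then have "b * f2 \<le> b * (1/2 - c/2 + 31/1000 * s)" using ab by (intro mult_left_mono) auto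
  also have "\<dots> \<le> (160/1000) * (1/2 - c/2 + 31/1000 * s)"
    using ab cs(1,2) by (intro mult_right_mono) auto
  finally have f2: "b * f2 \<le> (160/1000) * (1/2 - c/2 + 31/1000 * s)" .
  show ?thesis using 1 f1 f2 c0 s0 cs(1,2) unfolding a_def[symmetric] b_def[symmetric]
    unfolding cos_tilt sin_tilt by argo
qed

end

section \<open>Support functions and hexagons\<close>

definition support_fun :: "complex set \<Rightarrow> real \<Rightarrow> real" where
  "support_fun K t = (SUP x\<in>K. x \<bullet> cis t)"

lemma unit_width_dist: "unit_width K \<Longrightarrow> x \<in> K \<Longrightarrow> y \<in> K \<Longrightarrow> dist x y \<le> 1"
  by (simp add: unit_width_def)

text \<open>The far end of a unit chord in direction \<open>t\<close> is extreme in that direction,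
  because all points lie within 1 of its other end. Neither closedness nor convexity of
  \<open>K\<close> has to be carried along.\<close>

lemma support_fun_attained:
  assumes K: "unit_width K"
  obtains p where "p \<in> K" "p - cis t \<in> K" "p \<bullet> cis t = support_fun K t" "\<And>x. x \<in> K \<Longrightarrow> x \<bullet> cis t \<le> p \<bullet> cis t"
proof -
  from K obtain q where q: "q \<in> K" "q + cis t \<in> K" unfolding unit_width_def by blast
  have le: "x \<bullet> cis t \<le> (q + cis t) \<bullet> cis t" if "x \<in> K" for x
  proof -
    have "(x - q) \<bullet> cis t \<le> norm (x - q) * norm (cis t)" by (rule norm_cauchy_schwarz)
    also have "\<dots> \<le> 1" using unit_width_dist[OF K that q(1)] by (simp add: dist_norm)
    finally have "x \<bullet> cis t - q \<bullet> cis t \<le> 1" by (simp add: inner_diff_left)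
    moreover have "cis t \<bullet> cis t = 1" by (simp flip: norm_eq_1)
    ultimately show ?thesis by (simp add: inner_add_left)
  qed
  have "support_fun K t = (q + cis t) \<bullet> cis t"
    unfolding support_fun_def by (rule cSup_eq_maximum) (use q le in auto)
  then show ?thesis using q le by (intro that[of "q + cis t"]) auto
qed

lemma support_fun_ge: "unit_width K \<Longrightarrow> x \<in> K \<Longrightarrow> x \<bullet> cis t \<le> support_fun K t"
  by (metis support_fun_attained)

lemma support_fun_le:
  assumes "unit_width K" "\<And>x. x \<in> K \<Longrightarrow> x \<bullet> cis t \<le> b"
  shows "support_fun K t \<le> b"
  by (metis support_fun_attained[OF assms(1)] assms(2))

lemma cis_add_pi: "cis (t + pi) = - cis t"
  by (simp add: complex_eq_iff)

text \<open>Constant width: the unit chord gives one inequality and the distance bound the other.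
  This identity decides that one of two opposite cuts misses the body, and it turns upper bounds on
  supports into lower ones.\<close>

lemma support_fun_opposite:
  assumes K: "unit_width K"
  shows "support_fun K (t + pi) = 1 - support_fun K t"
proof -
  obtain p where p: "p \<in> K" "p - cis t \<in> K" "p \<bullet> cis t = support_fun K t"
    using support_fun_attained[OF K] by metis
  obtain q where q: "q \<in> K" "q - cis (t + pi) \<in> K" "q \<bullet> cis (t + pi) = support_fun K (t + pi)"
    using support_fun_attained[OF K] by metis
  have 1: "cis t \<bullet> cis t = 1" by (simp flip: norm_eq_1)
  have "1 - p \<bullet> cis t \<le> support_fun K (t + pi)"
    using support_fun_ge[OF K p(2), of "t + pi"] 1 by (simp add: cis_add_pi inner_diff_left)
  moreover have "(p - q) \<bullet> cis t \<le> norm (p - q) * norm (cis t)" by (rule norm_cauchy_schwarz)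
  then have "p \<bullet> cis t + q \<bullet> cis (t + pi) \<le> 1"
    using unit_width_dist[OF K p(1) q(1)] by (simp add: dist_norm cis_add_pi inner_diff_left)
  ultimately show ?thesis unfolding p(3) q(3) by linarith
qed

lemma support_fun_periodic: "support_fun K (t + 2 * pi) = support_fun K t"
  by (simp add: support_fun_def complex_eq_iff inner_cis)

text \<open>A bound \<open>M\<close> on the norms of the points makes the support function Lipschitz
  with constant \<open>M\<close> in the chordal distance of the directions.\<close>

lemma continuous_support_fun:
  assumes K: "unit_width K"
  shows "continuous_on UNIV (support_fun K)"
proof -
  obtain x0 where x0: "x0 \<in> K" using K by (auto simp: unit_width_def)
  define M where "M = norm x0 + 1"
  have M: "norm x \<le> M" if "x \<in> K" for x
    using unit_width_dist[OF K that x0] norm_triangle_sub[of x x0] by (simp add: M_def dist_norm)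
  have le: "support_fun K s - support_fun K t \<le> M * norm (cis s - cis t)" for s t
  proof -
    obtain p where p: "p \<in> K" "p \<bullet> cis s = support_fun K s" using support_fun_attained[OF K] by metis
    have "support_fun K s - support_fun K t \<le> p \<bullet> (cis s - cis t)"
      using p(2) support_fun_ge[OF K p(1), of t] by (simp add: inner_diff_right)
    also have "\<dots> \<le> norm p * norm (cis s - cis t)" by (rule norm_cauchy_schwarz)
    also have "\<dots> \<le> M * norm (cis s - cis t)" using M[OF p(1)] by (rule mult_right_mono) simp
    finally show ?thesis .
  qed
  have "isCont (support_fun K) t" for t
  proof -
    have "((\<lambda>s. M * norm (cis s - cis t)) \<longlongrightarrow> M * norm (cis t - cis t)) (at t)"
      unfolding cis_conv_exp by (intro tendsto_intros)
    then have lim: "((\<lambda>s. M * norm (cis s - cis t)) \<longlongrightarrow> 0) (at t)" by simp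
    have "norm (support_fun K s - support_fun K t) \<le> M * norm (cis s - cis t)" for s
      using le[of s t] le[of t s] by (simp add: abs_le_iff norm_minus_commute)
    then have "((\<lambda>s. support_fun K s - support_fun K t) \<longlongrightarrow> 0) (at t)"
      by (intro Lim_null_comparison[OF _ lim]) (simp add: always_eventually)
    then show ?thesis unfolding isCont_def by (rule LIM_zero_cancel)
  qed
  then show ?thesis by (simp add: continuous_at_imp_continuous_on)
qed

section \<open>Rigid motions and the mirror image\<close>

definition rigid_move :: "real \<Rightarrow> complex \<Rightarrow> complex \<Rightarrow> complex" where
  "rigid_move \<alpha> z x = cis (- \<alpha>) * (x - z)"

text \<open>The reflection in the line through 0 at angle pi / 3. It exchanges the corners A and F,
  B and E, C and D, the sides \<open>EF\<close> and \<open>AB\<close>, and the sides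
  \<open>BC\<close> and \<open>DE\<close>.\<close>

definition mirror :: "complex \<Rightarrow> complex" where
  "mirror x = cis (2 * pi / 3) * cnj x"

lemma inner_rigid_move: "rigid_move \<alpha> z x \<bullet> cis t = x \<bullet> cis (t + \<alpha>) - z \<bullet> cis (t + \<alpha>)"
  by (simp add: rigid_move_def inner_complex_def cos_add sin_add algebra_simps)

lemma inner_mirror: "mirror x \<bullet> cis t = x \<bullet> cis (2 * pi / 3 - t)"
  by (simp add: mirror_def inner_complex_def cos_diff sin_diff algebra_simps)

lemma dist_rigid_move: "dist (rigid_move \<alpha> z x) (rigid_move \<alpha> z y) = dist x y"
  by (simp add: rigid_move_def dist_norm norm_mult flip: right_diff_distrib)

lemma dist_mirror: "dist (mirror x) (mirror y) = dist x y"
  by (simp add: mirror_def dist_norm norm_mult flip: right_diff_distrib complex_cnj_diff)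

lemma unit_width_rigid_move:
  assumes K: "unit_width K"
  shows "unit_width (rigid_move \<alpha> z ` K)"
  unfolding unit_width_def
proof (intro conjI allI)
  show "\<forall>x\<in>rigid_move \<alpha> z ` K. \<forall>y\<in>rigid_move \<alpha> z ` K. dist x y \<le> 1"
    using unit_width_dist[OF K] by (auto simp: dist_rigid_move)
  fix t
  from K obtain q where q: "q \<in> K" "q + cis (t + \<alpha>) \<in> K" unfolding unit_width_def by blast
  have "rigid_move \<alpha> z (q + cis (t + \<alpha>)) = rigid_move \<alpha> z q + cis t"
    by (simp add: rigid_move_def algebra_simps cis_mult)
  with q show "\<exists>q\<in>rigid_move \<alpha> z ` K. q + cis t \<in> rigid_move \<alpha> z ` K"
    by (intro bexI[of _ "rigid_move \<alpha> z q"]) (metis image_eqI)+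
qed

lemma unit_width_mirror:
  assumes K: "unit_width K"
  shows "unit_width (mirror ` K)"
  unfolding unit_width_def
proof (intro conjI allI)
  show "\<forall>x\<in>mirror ` K. \<forall>y\<in>mirror ` K. dist x y \<le> 1"
    using unit_width_dist[OF K] by (auto simp: dist_mirror)
  fix t
  from K obtain q where q: "q \<in> K" "q + cis (2 * pi / 3 - t) \<in> K" unfolding unit_width_def by blast
  have "mirror (q + cis (2 * pi / 3 - t)) = mirror q + cis t"
    by (simp add: mirror_def algebra_simps cis_cnj cis_mult)
  with q show "\<exists>q\<in>mirror ` K. q + cis t \<in> mirror ` K"
    by (intro bexI[of _ "mirror q"]) (metis image_eqI)+
qed

lemma support_fun_image:
  assumes K: "unit_width K" and fK: "unit_width (f ` K)" and eq: "\<And>x. f x \<bullet> cis t = x \<bullet> cis s - d"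
  shows "support_fun (f ` K) t = support_fun K s - d"
proof (rule antisym)
  show "support_fun (f ` K) t \<le> support_fun K s - d"
    by (rule support_fun_le[OF fK]) (use eq support_fun_ge[OF K, of _ s] in auto)
  have "support_fun K s \<le> support_fun (f ` K) t + d"
  proof (rule support_fun_le[OF K])
    fix x assume "x \<in> K"
    then have "f x \<bullet> cis t \<le> support_fun (f ` K) t" by (intro support_fun_ge[OF fK]) auto
    then show "x \<bullet> cis s \<le> support_fun (f ` K) t + d" by (simp add: eq)
  qed
  then show "support_fun K s - d \<le> support_fun (f ` K) t" by simp
qed

lemma support_fun_rigid_move:
  "unit_width K \<Longrightarrow> support_fun (rigid_move \<alpha> z ` K) t = support_fun K (t + \<alpha>) - z \<bullet> cis (t + \<alpha>)"
  by (intro support_fun_image unit_width_rigid_move inner_rigid_move)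

lemma support_fun_mirror:
  "unit_width K \<Longrightarrow> support_fun (mirror ` K) t = support_fun K (2 * pi / 3 - t)"
  using support_fun_image[of K mirror t "2 * pi / 3 - t" 0] unit_width_mirror by (simp add: inner_mirror)

lemma cos_sin_thirds:
  "cos (t + 2 * pi / 3) = - cos t / 2 - sqrt 3 / 2 * sin t" "sin (t + 2 * pi / 3) = - sin t / 2 + sqrt 3 / 2 * cos t"
  "cos (t + 4 * pi / 3) = - cos t / 2 + sqrt 3 / 2 * sin t" "sin (t + 4 * pi / 3) = - sin t / 2 - sqrt 3 / 2 * cos t"
  "cos (t + pi / 3) = cos t / 2 - sqrt 3 / 2 * sin t" "sin (t + pi / 3) = sin t / 2 + sqrt 3 / 2 * cos t"
  "cos (t + 5 * pi / 3) = cos t / 2 + sqrt 3 / 2 * sin t" "sin (t + 5 * pi / 3) = sin t / 2 - sqrt 3 / 2 * cos t"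
proof -
  have e: "2 * pi / 3 = pi - pi / 3" "4 * pi / 3 = pi / 3 + pi" "5 * pi / 3 = 2 * pi - pi / 3"
    by simp_all
  have c: "cos (2 * pi / 3) = - 1/2" "sin (2 * pi / 3) = sqrt 3 / 2" "cos (4 * pi / 3) = - 1/2"
    "sin (4 * pi / 3) = - sqrt 3 / 2" "cos (5 * pi / 3) = 1/2" "sin (5 * pi / 3) = - sqrt 3 / 2"
    unfolding e by (simp_all only: cos_diff sin_diff cos_add sin_add, simp_all add: cos_60 sin_60)
  show "cos (t + 2 * pi / 3) = - cos t / 2 - sqrt 3 / 2 * sin t" "sin (t + 2 * pi / 3) = - sin t / 2 + sqrt 3 / 2 * cos t"
  "cos (t + 4 * pi / 3) = - cos t / 2 + sqrt 3 / 2 * sin t" "sin (t + 4 * pi / 3) = - sin t / 2 - sqrt 3 / 2 * cos t"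
  "cos (t + pi / 3) = cos t / 2 - sqrt 3 / 2 * sin t" "sin (t + pi / 3) = sin t / 2 + sqrt 3 / 2 * cos t"
  "cos (t + 5 * pi / 3) = cos t / 2 + sqrt 3 / 2 * sin t" "sin (t + 5 * pi / 3) = sin t / 2 - sqrt 3 / 2 * cos t"
    unfolding cos_add sin_add c by (simp_all add: cos_60 sin_60)
qed

section \<open>Standard position and the zeros of \<open>Pal\<close>\<close>

definition std_frame :: "complex set \<Rightarrow> bool" where
  "std_frame K \<longleftrightarrow> unit_width K \<and> (\<forall>j::int. support_fun K (j * pi / 3) = 1/2)"

text \<open>The three normals sum to 0, so the midlines of the three circumscribed strips of width 1
  are concurrent exactly when this vanishes; the strips then meet in a regular hexagon.\<close>

definition Pal :: "complex set \<Rightarrow> real \<Rightarrow> real" where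
  "Pal K t = support_fun K t + support_fun K (t + 2 * pi / 3) + support_fun K (t + 4 * pi / 3) - 3/2"

text \<open>Three unit vectors at mutual angles of 2 pi / 3 form a tight frame with constant 3/2,
  hence the factor 2/3. At a zero of \<open>Pal\<close> this is the common point of the
  midlines.\<close>

definition hex_centre :: "complex set \<Rightarrow> real \<Rightarrow> complex" where
  "hex_centre K t = of_real (2/3) *
     (of_real (support_fun K t - 1/2) * cis t
      + of_real (support_fun K (t + 2 * pi / 3) - 1/2) * cis (t + 2 * pi / 3)
      + of_real (support_fun K (t + 4 * pi / 3) - 1/2) * cis (t + 4 * pi / 3))"

lemma support_fun_flip:
  assumes "unit_width K"
  shows "support_fun K (t + pi / 3) = 1 - support_fun K (t + 4 * pi / 3)"
    "support_fun K (t + pi / 3 + 2 * pi / 3) = 1 - support_fun K t"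
    "support_fun K (t + pi / 3 + 4 * pi / 3) = 1 - support_fun K (t + 2 * pi / 3)"
proof -
  have e: "t + 4 * pi / 3 = t + pi / 3 + pi" "t + pi / 3 + 2 * pi / 3 = t + pi"
    "t + pi / 3 + 4 * pi / 3 = t + 2 * pi / 3 + pi" by simp_all
  show "support_fun K (t + pi / 3) = 1 - support_fun K (t + 4 * pi / 3)"
    "support_fun K (t + pi / 3 + 2 * pi / 3) = 1 - support_fun K t"
    "support_fun K (t + pi / 3 + 4 * pi / 3) = 1 - support_fun K (t + 2 * pi / 3)"
    unfolding e support_fun_opposite[OF assms] by simp_all
qed

text \<open>The rotation by pi / 3 replaces the three normals by their opposites, and by constant
  width each support then changes from \<open>h\<close> to \<open>1 - h\<close>.\<close>

lemma Pal_anti: "unit_width K \<Longrightarrow> Pal K (t + pi / 3) = - Pal K t"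
  unfolding Pal_def support_fun_flip by simp

lemma hex_centre_shift:
  assumes K: "unit_width K"
  shows "hex_centre K (t + pi / 3) = hex_centre K t"
proof -
  have c: "cis (t + pi / 3) = - cis (t + 4 * pi / 3)" "cis (t + pi / 3 + 2 * pi / 3) = - cis t"
    "cis (t + pi / 3 + 4 * pi / 3) = - cis (t + 2 * pi / 3)"
  proof -
    have e: "t + 4 * pi / 3 = t + pi / 3 + pi" "t + pi / 3 + 2 * pi / 3 = t + pi"
      "t + pi / 3 + 4 * pi / 3 = t + 2 * pi / 3 + pi" by simp_all
    show "cis (t + pi / 3) = - cis (t + 4 * pi / 3)" "cis (t + pi / 3 + 2 * pi / 3) = - cis t"
      "cis (t + pi / 3 + 4 * pi / 3) = - cis (t + 2 * pi / 3)"
      unfolding e cis_add_pi by simp_all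
  qed
  show ?thesis unfolding hex_centre_def support_fun_flip[OF K] c by (simp add: algebra_simps)
qed

lemma hex_centre_inner:
  assumes "Pal K t = 0"
  shows "hex_centre K t \<bullet> cis t = support_fun K t - 1/2"
    "hex_centre K t \<bullet> cis (t + 2 * pi / 3) = support_fun K (t + 2 * pi / 3) - 1/2"
    "hex_centre K t \<bullet> cis (t + 4 * pi / 3) = support_fun K (t + 4 * pi / 3) - 1/2"
proof -
  define f0 where "f0 = support_fun K t - 1/2"
  define f1 where "f1 = support_fun K (t + 2 * pi / 3) - 1/2"
  define f2 where "f2 = support_fun K (t + 4 * pi / 3) - 1/2"
  have sum: "f2 = - f0 - f1" using assms by (simp add: Pal_def f0_def f1_def f2_def)
  define c s q where "c = cos t" and "s = sin t" and "q = sqrt (3::real)"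
  have cs: "c * c + s * s = 1" unfolding c_def s_def by (metis power2_eq_square sin_cos_squared_add2)
  have qq: "q * q = 3" by (simp add: q_def)
  have re: "Re (hex_centre K t) = 2/3 * (f0 * c + f1 * (- c / 2 - q / 2 * s) + f2 * (- c / 2 + q / 2 * s))"
    and im: "Im (hex_centre K t) = 2/3 * (f0 * s + f1 * (- s / 2 + q / 2 * c) + f2 * (- s / 2 - q / 2 * c))"
    by (simp_all add: hex_centre_def f0_def f1_def f2_def cos_sin_thirds c_def s_def q_def)
  have 0: "hex_centre K t \<bullet> cis t = f0 * (c * c + s * s)"
    unfolding inner_cis re im c_def[symmetric] s_def[symmetric] sum by (simp add: field_simps)
  have "hex_centre K t \<bullet> cis (t + 2 * pi / 3) = 2/3 * (f0 * (q * q / 4 - 3/4) + f1 * (q * q / 2)) * (c * c + s * s)"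
    unfolding inner_cis re im cos_sin_thirds c_def[symmetric] s_def[symmetric] q_def[symmetric] sum
    by (simp add: field_simps)
  then have 1: "hex_centre K t \<bullet> cis (t + 2 * pi / 3) = f1 * (c * c + s * s)" unfolding qq by simp
  have "hex_centre K t \<bullet> cis (t + 4 * pi / 3) = 2/3 * (f0 * (- (q * q) / 4 - 3/4) - f1 * (q * q / 2)) * (c * c + s * s)"
    unfolding inner_cis re im cos_sin_thirds c_def[symmetric] s_def[symmetric] q_def[symmetric] sum
    by (simp add: field_simps)
  moreover have "2/3 * (f0 * (- (q * q) / 4 - 3/4) - f1 * (q * q / 2)) = f2" unfolding qq sum by (simp add: field_simps)
  ultimately have 2: "hex_centre K t \<bullet> cis (t + 4 * pi / 3) = f2 * (c * c + s * s)" by metis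
  show "hex_centre K t \<bullet> cis t = support_fun K t - 1/2"
    "hex_centre K t \<bullet> cis (t + 2 * pi / 3) = support_fun K (t + 2 * pi / 3) - 1/2"
    "hex_centre K t \<bullet> cis (t + 4 * pi / 3) = support_fun K (t + 4 * pi / 3) - 1/2"
    using 0 1 2 cs by (simp_all add: f0_def f1_def f2_def)
qed

lemma support_fun_periodic_minus: "support_fun K (t - 2 * pi) = support_fun K t"
  using support_fun_periodic[of K "t - 2 * pi"] by simp

lemma cos_sin_sixths:
  "cos (11 * pi / 6 + t) = sqrt 3 / 2 * cos t + sin t / 2" "sin (11 * pi / 6 + t) = sqrt 3 / 2 * sin t - cos t / 2"
  "cos (7 * pi / 6 + t) = sin t / 2 - sqrt 3 / 2 * cos t" "sin (7 * pi / 6 + t) = - cos t / 2 - sqrt 3 / 2 * sin t"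
  "cos (5 * pi / 6 + t) = - sin t / 2 - sqrt 3 / 2 * cos t" "sin (5 * pi / 6 + t) = cos t / 2 - sqrt 3 / 2 * sin t"
  "cos (3 * pi / 2 + t) = sin t" "sin (3 * pi / 2 + t) = - cos t"
proof -
  have e: "11 * pi / 6 = 2 * pi - pi / 6" "7 * pi / 6 = pi / 6 + pi" "5 * pi / 6 = pi - pi / 6" "3 * pi / 2 = pi + pi / 2"
    by simp_all
  show "cos (11 * pi / 6 + t) = sqrt 3 / 2 * cos t + sin t / 2" "sin (11 * pi / 6 + t) = sqrt 3 / 2 * sin t - cos t / 2"
  "cos (7 * pi / 6 + t) = sin t / 2 - sqrt 3 / 2 * cos t" "sin (7 * pi / 6 + t) = - cos t / 2 - sqrt 3 / 2 * sin t"
  "cos (5 * pi / 6 + t) = - sin t / 2 - sqrt 3 / 2 * cos t" "sin (5 * pi / 6 + t) = cos t / 2 - sqrt 3 / 2 * sin t"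
  "cos (3 * pi / 2 + t) = sin t" "sin (3 * pi / 2 + t) = - cos t"
    unfolding e by (simp_all only: cos_diff sin_diff cos_add sin_add, simp_all add: cos_30 sin_30)
qed

lemma std_frameD:
  assumes "std_frame K"
  shows "unit_width K" "support_fun K (of_int j * pi / 3) = 1/2"
  using assms by (auto simp: std_frame_def)

text \<open>The unit chords along the normals end at contact points on opposite sides. Each chord is
  perpendicular to its two sides, so one offset describes both ends.\<close>

lemma std_frame_contacts:
  assumes "std_frame K"
  obtains \<epsilon> \<phi> \<gamma> where "hexagonal_body K \<epsilon> \<phi> \<gamma>"
proof -
  note K = std_frameD(1)[OF assms]
  have h: "support_fun K 0 = 1/2" "support_fun K (5 * pi / 3) = 1/2" "support_fun K (4 * pi / 3) = 1/2"
    using std_frameD(2)[OF assms, of 0] std_frameD(2)[OF assms, of 5] std_frameD(2)[OF assms, of 4] by simp_all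
  have cs: "cos (5 * pi / 3) = 1/2" "sin (5 * pi / 3) = - sqrt 3 / 2" "cos (4 * pi / 3) = - 1/2" "sin (4 * pi / 3) = - sqrt 3 / 2"
    using cos_sin_thirds[of 0] by simp_all
  have ci: "cis (5 * pi / 3) = Complex (1/2) (- sqrt 3 / 2)" "cis (4 * pi / 3) = Complex (- 1/2) (- sqrt 3 / 2)"
    using cs by (simp_all add: complex_eq_iff)
  obtain p where p: "p \<in> K" "p - cis 0 \<in> K" "p \<bullet> cis 0 = 1/2" using support_fun_attained[OF K] h(1) by metis
  obtain q where q: "q \<in> K" "q - cis (5 * pi / 3) \<in> K" "q \<bullet> cis (5 * pi / 3) = 1/2" using support_fun_attained[OF K] h(2) by metis
  obtain r where r: "r \<in> K" "r - cis (4 * pi / 3) \<in> K" "r \<bullet> cis (4 * pi / 3) = 1/2" using support_fun_attained[OF K] h(3) by metis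
  have qe: "Re q = 1 + sqrt 3 * Im q" and re: "Re r = - 1 - sqrt 3 * Im r"
    using q(3) r(3) unfolding inner_cis cs by (simp_all add: field_simps)
  define \<phi> where "\<phi> = sqrt 3 / 2 * Re q + Im q / 2"
  define \<gamma> where "\<gamma> = sqrt 3 / 2 * Re r - Im r / 2"
  have P: "p = Complex (1/2) (Im p)" "p - cis 0 = Complex (-1/2) (Im p)"
    using p(3) by (simp_all add: inner_cis complex_eq_iff)
  have Q: "q = Complex (1/4 + \<phi> * sqrt 3 / 2) (- sqrt 3 / 4 + \<phi> / 2)"
    "q - cis (5 * pi / 3) = Complex (- 1/4 + \<phi> * sqrt 3 / 2) (sqrt 3 / 4 + \<phi> / 2)"
    unfolding ci by (simp_all add: complex_eq_iff \<phi>_def qe field_simps)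
  have R: "r = Complex (- 1/4 + \<gamma> * sqrt 3 / 2) (- sqrt 3 / 4 - \<gamma> / 2)"
    "r - cis (4 * pi / 3) = Complex (1/4 + \<gamma> * sqrt 3 / 2) (sqrt 3 / 4 - \<gamma> / 2)"
    unfolding ci by (simp_all add: complex_eq_iff \<gamma>_def re field_simps)
  have "hexagonal_body K (Im p) \<phi> \<gamma>"
    using unit_width_dist[OF K] p(1,2) q(1,2) r(1,2)
    unfolding P(2) Q(2) R(2) unfolding hexagonal_body_def
    by (metis P(1) Q(1) R(1))
  then show ?thesis by (rule that)
qed

text \<open>The chord from \<open>CD\<close> to \<open>FA\<close> is parallel to the axis of the
  reflection, so its offset changes sign, while the other two chords are exchanged. Estimates need
  to be proved on one side only.\<close>

lemma hexagonal_body_mirror: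
  assumes "hexagonal_body K \<epsilon> \<phi> \<gamma>"
  shows "hexagonal_body (mirror ` K) \<phi> \<epsilon> (- \<gamma>)"
proof -
  interpret hexagonal_body K \<epsilon> \<phi> \<gamma> by fact
  have cs: "cos (2 * pi / 3) = - 1/2" "sin (2 * pi / 3) = sqrt 3 / 2"
    using cos_sin_thirds[of 0] by simp_all
  have m: "mirror (Complex x y) = Complex (- x / 2 + sqrt 3 / 2 * y) (sqrt 3 / 2 * x + y / 2)" for x y
    by (simp add: mirror_def complex_eq_iff cs)
  show ?thesis
  proof
    show "dist x y \<le> 1" if "x \<in> mirror ` K" "y \<in> mirror ` K" for x y
      using that dist_le by (auto simp: dist_mirror)
    have "mirror (Complex (- 1/4 + \<phi> * sqrt 3 / 2) (sqrt 3 / 4 + \<phi> / 2)) = Complex (1/2) \<phi>"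
      "mirror (Complex (1/4 + \<phi> * sqrt 3 / 2) (- sqrt 3 / 4 + \<phi> / 2)) = Complex (-1/2) \<phi>"
      "mirror (Complex (-1/2) \<epsilon>) = Complex (1/4 + \<epsilon> * sqrt 3 / 2) (- sqrt 3 / 4 + \<epsilon> / 2)"
      "mirror (Complex (1/2) \<epsilon>) = Complex (- 1/4 + \<epsilon> * sqrt 3 / 2) (sqrt 3 / 4 + \<epsilon> / 2)"
      "mirror (Complex (- 1/4 + \<gamma> * sqrt 3 / 2) (- sqrt 3 / 4 - \<gamma> / 2)) = Complex (- 1/4 + (- \<gamma>) * sqrt 3 / 2) (- sqrt 3 / 4 - (- \<gamma>) / 2)"
      "mirror (Complex (1/4 + \<gamma> * sqrt 3 / 2) (sqrt 3 / 4 - \<gamma> / 2)) = Complex (1/4 + (- \<gamma>) * sqrt 3 / 2) (sqrt 3 / 4 - (- \<gamma>) / 2)"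
      unfolding m by (simp_all add: field_simps)
    then show "Complex (1/2) \<phi> \<in> mirror ` K" "Complex (-1/2) \<phi> \<in> mirror ` K"
      "Complex (1/4 + \<epsilon> * sqrt 3 / 2) (- sqrt 3 / 4 + \<epsilon> / 2) \<in> mirror ` K"
      "Complex (- 1/4 + \<epsilon> * sqrt 3 / 2) (sqrt 3 / 4 + \<epsilon> / 2) \<in> mirror ` K"
      "Complex (- 1/4 + (- \<gamma>) * sqrt 3 / 2) (- sqrt 3 / 4 - (- \<gamma>) / 2) \<in> mirror ` K"
      "Complex (1/4 + (- \<gamma>) * sqrt 3 / 2) (sqrt 3 / 4 - (- \<gamma>) / 2) \<in> mirror ` K"
      using AB DE BC EF CD FA by (metis image_eqI)+
  qed
qed

lemma std_frame_mirror:
  assumes "std_frame K"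
  shows "std_frame (mirror ` K)"
proof -
  note K = std_frameD(1)[OF assms]
  have "support_fun (mirror ` K) (of_int j * pi / 3) = 1/2" for j
  proof -
    have "2 * pi / 3 - of_int j * pi / 3 = of_int (2 - j) * pi / 3" by (simp add: field_simps)
    then show ?thesis unfolding support_fun_mirror[OF K] using std_frameD(2)[OF assms, of "2 - j"] by metis
  qed
  then show ?thesis using unit_width_mirror[OF K] by (simp add: std_frame_def)
qed

text \<open>A contact point cannot lie beyond a line that misses the body. The constants are the
  offsets where the cut meets the side, rounded up:
  \<open>(1 - cos (pi/6 + slant)) / (2 * cos (pi/3 - slant))\<close> for 0.141506, and the same with
  \<open>slant\<close> negated for 0.1265002.\<close>

lemma offset_le_of_cut:
  assumes hb: "hexagonal_body K \<epsilon> \<phi> \<gamma>" and K: "unit_width K"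
  shows "support_fun K (11 * pi / 6 + slant) \<le> 1/2 \<Longrightarrow> \<phi> \<le> 141506/1000000"
    "support_fun K (11 * pi / 6 - slant) \<le> 1/2 \<Longrightarrow> \<phi> \<le> 1265002/10000000"
    "support_fun K (7 * pi / 6 + slant) \<le> 1/2 \<Longrightarrow> - \<gamma> \<le> 1265002/10000000"
proof -
  interpret hexagonal_body K \<epsilon> \<phi> \<gamma> by fact
  define q where "q = sqrt (3::real)"
  have q: "17320508075/10000000000 < q" "q < 17320508076/10000000000" and qq: "q * q = 3" "\<And>x. q * (q * x) = 3 * x"
    using sqrt3_bounds by (simp_all add: q_def)
  note ob = offset_bounds
  have near: "q * x \<le> 17320508/10000000 * x + 1/10000000" "q * x \<ge> 17320508/10000000 * x - 1/10000000" if "\<bar>x\<bar> \<le> 1" for x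
    by (rule mult_near; use q that in \<open>simp add: abs_le_iff\<close>)+
  show "\<phi> \<le> 141506/1000000" if "support_fun K (11 * pi / 6 + slant) \<le> 1/2"
    using order_trans[OF support_fun_ge[OF K DE] that] near[OF ob(2)] q
    unfolding inner_cis cos_sin_sixths cos_slant sin_slant q_def[symmetric]
    by (simp add: algebra_simps qq) argo
  show "\<phi> \<le> 1265002/10000000" if "support_fun K (11 * pi / 6 - slant) \<le> 1/2"
    using order_trans[OF support_fun_ge[OF K DE] that] near[OF ob(2)] q
    unfolding inner_cis diff_conv_add_uminus[of "11 * pi / 6"] cos_sin_sixths cos_minus sin_minus cos_slant sin_slant q_def[symmetric]
    by (simp add: algebra_simps qq) argo
  show "- \<gamma> \<le> 1265002/10000000" if "support_fun K (7 * pi / 6 + slant) \<le> 1/2"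
    using order_trans[OF support_fun_ge[OF K CD] that] near[OF ob(3)] q
    unfolding inner_cis cos_sin_sixths cos_slant sin_slant q_def[symmetric]
    by (simp add: algebra_simps qq) argo
qed

text \<open>What remains when neither \<open>K\<close> nor its mirror image fits. The conditions
  near B and D are the cuts at E and C for the mirror image, and the second violating point is the
  first one for the mirror image; hence the notion is invariant under \<open>mirror\<close>.\<close>

definition bad_frame :: "complex set \<Rightarrow> bool" where
  "bad_frame K \<longleftrightarrow> std_frame K
     \<and> support_fun K (11 * pi / 6 + slant) \<le> 1/2 \<and> support_fun K (7 * pi / 6 + slant) \<le> 1/2
     \<and> support_fun K (5 * pi / 6 - slant) \<le> 1/2 \<and> support_fun K (3 * pi / 2 - slant) \<le> 1/2
     \<and> (\<exists>x\<in>K. x \<bullet> cis (2 * pi / 3 - tilt) > 5223061/10000000)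
     \<and> (\<exists>y\<in>K. y \<bullet> cis tilt > 5223061/10000000)"

lemma support_fun_mirror_cuts:
  assumes "unit_width K"
  shows "support_fun (mirror ` K) (11 * pi / 6 + slant) = support_fun K (5 * pi / 6 - slant)"
    "support_fun (mirror ` K) (7 * pi / 6 + slant) = support_fun K (3 * pi / 2 - slant)"
    "support_fun (mirror ` K) (5 * pi / 6 - slant) = support_fun K (11 * pi / 6 + slant)"
    "support_fun (mirror ` K) (3 * pi / 2 - slant) = support_fun K (7 * pi / 6 + slant)"
proof -
  have e: "2 * pi / 3 - (11 * pi / 6 + slant) = 5 * pi / 6 - slant - 2 * pi"
    "2 * pi / 3 - (7 * pi / 6 + slant) = 3 * pi / 2 - slant - 2 * pi"
    "2 * pi / 3 - (5 * pi / 6 - slant) = 11 * pi / 6 + slant - 2 * pi"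
    "2 * pi / 3 - (3 * pi / 2 - slant) = 7 * pi / 6 + slant - 2 * pi"
    by (simp_all add: field_simps)
  show "support_fun (mirror ` K) (11 * pi / 6 + slant) = support_fun K (5 * pi / 6 - slant)"
    "support_fun (mirror ` K) (7 * pi / 6 + slant) = support_fun K (3 * pi / 2 - slant)"
    "support_fun (mirror ` K) (5 * pi / 6 - slant) = support_fun K (11 * pi / 6 + slant)"
    "support_fun (mirror ` K) (3 * pi / 2 - slant) = support_fun K (7 * pi / 6 + slant)"
    unfolding support_fun_mirror[OF assms] e support_fun_periodic_minus by (rule refl)+
qed

lemma bad_frame_mirror:
  assumes "bad_frame K"
  shows "bad_frame (mirror ` K)"
  using assms support_fun_mirror_cuts[of K] std_frame_mirror[of K] std_frameD(1)[of K]
  unfolding bad_frame_def by (auto simp: inner_mirror)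

text \<open>Half of the inequalities come from the mirror image. Together they confine \<epsilon>
  and \<phi> to roughly [0.105, 0.1416] and \<gamma> to roughly [-0.031, 0.031].\<close>

lemma bad_frame_offsets:
  assumes bad: "bad_frame K" and hb: "hexagonal_body K \<epsilon> \<phi> \<gamma>"
  shows "\<epsilon> \<le> 141506/1000000" "\<phi> \<le> 141506/1000000"
    "66999/1000000 * \<epsilon> + 39014/1000000 * \<gamma> \<ge> 82839/10000000"
    "66999/1000000 * \<phi> - 39014/1000000 * \<gamma> \<ge> 82839/10000000"
proof -
  have lens: "66999/1000000 * e + 39014/1000000 * g \<ge> 82839/10000000" and pm: "f \<le> 141506/1000000"
    if "bad_frame L" "hexagonal_body L e f g" for L e f g
  proof -
    interpret hexagonal_body L e f g by fact
    show "66999/1000000 * e + 39014/1000000 * g \<ge> 82839/10000000"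
      using that(1) lens_offsets by (auto simp: bad_frame_def inner_cis)
    show "f \<le> 141506/1000000" using that offset_le_of_cut(1)[OF that(2)] by (auto simp: bad_frame_def std_frame_def)
  qed
  note m = bad_frame_mirror[OF bad] hexagonal_body_mirror[OF hb]
  show "\<epsilon> \<le> 141506/1000000" "\<phi> \<le> 141506/1000000"
    "66999/1000000 * \<epsilon> + 39014/1000000 * \<gamma> \<ge> 82839/10000000"
    "66999/1000000 * \<phi> - 39014/1000000 * \<gamma> \<ge> 82839/10000000"
    using lens[OF bad hb] lens[OF m] pm[OF bad hb] pm[OF m] by simp_all
qed

lemma Pal_mirror:
  assumes "unit_width K"
  shows "Pal (mirror ` K) t = Pal K (- t)"
proof -
  have e: "2 * pi / 3 - t = - t + 2 * pi / 3" "2 * pi / 3 - (t + 2 * pi / 3) = - t"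
    "2 * pi / 3 - (t + 4 * pi / 3) = - t + 4 * pi / 3 - 2 * pi"
    by (simp_all add: field_simps)
  show ?thesis unfolding Pal_def support_fun_mirror[OF assms] e support_fun_periodic_minus by simp
qed

text \<open>The violating point lifts the support at \<open>tilt\<close> above 0.5223061. The two
  other supports are bounded below, one through constant width and \<open>support_DE_side\<close>,
  the other by the contact point on \<open>CD\<close>. Reflection reverses the argument of
  \<open>Pal\<close>, which gives the second claim.\<close>

lemma bad_frame_Pal_pos:
  assumes "bad_frame K"
  shows "Pal K tilt > 0" "Pal K (- tilt) > 0"
proof -
  have *: "Pal L tilt > 0" if bad: "bad_frame L" for L
  proof -
    have std: "std_frame L" using bad by (simp add: bad_frame_def)
    note L = std_frameD(1)[OF std]
    obtain \<epsilon> \<phi> \<gamma> where hb: "hexagonal_body L \<epsilon> \<phi> \<gamma>" by (rule std_frame_contacts[OF std])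
    interpret hexagonal_body L \<epsilon> \<phi> \<gamma> by fact
    obtain y where y: "y \<in> L" "y \<bullet> cis tilt > 5223061/10000000" using bad by (auto simp: bad_frame_def)
    have 0: "support_fun L tilt > 5223061/10000000" using support_fun_ge[OF L y(1), of tilt] y(2) by simp
    have "support_fun L (tilt + 5 * pi / 3) \<le> cos tilt / 2 + (2 - sqrt 3 - \<epsilon>) * sin tilt"
    proof (rule support_fun_le[OF L])
      fix z assume z: "z \<in> L"
      have "sqrt 3 * sin tilt \<le> 2 * sin tilt" using sqrt3_bounds by (intro mult_right_mono) (auto simp: sin_tilt)
      then have "sqrt 3 * sin tilt \<le> cos tilt" by (simp add: sin_tilt cos_tilt)
      from support_DE_side[OF z _ this]
      show "z \<bullet> cis (tilt + 5 * pi / 3) \<le> cos tilt / 2 + (2 - sqrt 3 - \<epsilon>) * sin tilt"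
        by (simp add: inner_cis cos_sin_thirds sin_tilt)
    qed
    moreover have "tilt + 5 * pi / 3 = tilt + 2 * pi / 3 + pi" by simp
    ultimately have 1: "support_fun L (tilt + 2 * pi / 3) \<ge> 1 - (cos tilt / 2 + (2 - sqrt 3 - \<epsilon>) * sin tilt)"
      using support_fun_opposite[OF L, of "tilt + 2 * pi / 3"] by simp
    have "Complex (- 1/4 + \<gamma> * sqrt 3 / 2) (- sqrt 3 / 4 - \<gamma> / 2) \<bullet> cis (tilt + 4 * pi / 3) = cos tilt / 2 + \<gamma> * sin tilt"
      unfolding inner_cis cos_sin_thirds by (simp add: field_simps)
    then have 2: "support_fun L (tilt + 4 * pi / 3) \<ge> cos tilt / 2 + \<gamma> * sin tilt"
      using support_fun_ge[OF L CD, of "tilt + 4 * pi / 3"] by simp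
    have "(5223061/10000000 - 1/2) + sin tilt * (\<epsilon> + \<gamma> - (2 - sqrt 3)) > 0"
      by (rule lens_offsets_sum[OF y(1)]) (use y(2) bad_frame_offsets[OF bad hb] in \<open>simp_all add: inner_cis\<close>)
    then show ?thesis unfolding Pal_def using 0 1 2 by (simp add: algebra_simps)
  qed
  show "Pal K tilt > 0" using *[OF assms] .
  show "Pal K (- tilt) > 0"
    using *[OF bad_frame_mirror[OF assms]] Pal_mirror[of K tilt] assms by (simp add: bad_frame_def std_frame_def)
qed

text \<open>Locates the centre of a second hexagon turned by \<rho>. Upper bounds on supports come
  from a side and from unit discs about contact points, lower bounds from contact points being in
  \<open>K\<close>, and constant width trades one kind for the other.\<close>

lemma second_frame_bounds:
  assumes std: "std_frame K" and hb: "hexagonal_body K \<epsilon> \<phi> \<gamma>"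
    and o: "o1 \<bullet> cis \<rho> = support_fun K \<rho> - 1/2"
      "o1 \<bullet> cis (\<rho> + 2 * pi / 3) = support_fun K (\<rho> + 2 * pi / 3) - 1/2"
      "o1 \<bullet> cis (\<rho> + 4 * pi / 3) = support_fun K (\<rho> + 4 * pi / 3) - 1/2"
    and \<rho>: "sin \<rho> \<ge> 0" "sqrt 3 * sin \<rho> \<le> cos \<rho>"
  shows "o1 \<bullet> cis \<rho> + o1 \<bullet> cis (\<rho> + 2 * pi / 3) + o1 \<bullet> cis (\<rho> + 4 * pi / 3) = 0"
    "o1 \<bullet> cis \<rho> \<le> 1/2 - cos \<rho> / 2 + \<epsilon> * sin \<rho>"
    "o1 \<bullet> cis (\<rho> + 2 * pi / 3) \<ge> 1/2 - cos \<rho> / 2 - (2 - sqrt 3 - \<epsilon>) * sin \<rho>"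
    "o1 \<bullet> cis (\<rho> + 2 * pi / 3) \<le> 1/2 - cos \<rho> / 2 - \<phi> * sin \<rho>"
    "o1 \<bullet> cis (\<rho> + 4 * pi / 3) \<ge> cos \<rho> / 2 + \<gamma> * sin \<rho> - 1/2"
    "o1 \<bullet> cis (\<rho> + 4 * pi / 3) \<le> 1/2 - cos \<rho> / 2 + \<gamma> * sin \<rho>"
proof -
  note K = std_frameD(1)[OF std]
  interpret hexagonal_body K \<epsilon> \<phi> \<gamma> by fact
  show "o1 \<bullet> cis \<rho> + o1 \<bullet> cis (\<rho> + 2 * pi / 3) + o1 \<bullet> cis (\<rho> + 4 * pi / 3) = 0"
    unfolding inner_cis cos_sin_thirds by (simp add: field_simps)
  have "support_fun K \<rho> \<le> 1 - cos \<rho> / 2 + \<epsilon> * sin \<rho>"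
    by (rule support_fun_le[OF K], use disc_cis[OF BC, of _ \<rho>] in \<open>simp add: inner_cis algebra_simps\<close>)
  then show "o1 \<bullet> cis \<rho> \<le> 1/2 - cos \<rho> / 2 + \<epsilon> * sin \<rho>" using o(1) by simp
  have e: "\<rho> + 5 * pi / 3 = \<rho> + 2 * pi / 3 + pi" by simp
  have opp: "support_fun K (\<rho> + 5 * pi / 3) = 1 - support_fun K (\<rho> + 2 * pi / 3)"
    unfolding e by (rule support_fun_opposite[OF K])
  have "support_fun K (\<rho> + 5 * pi / 3) \<le> cos \<rho> / 2 + (2 - sqrt 3 - \<epsilon>) * sin \<rho>"
    by (rule support_fun_le[OF K], use support_DE_side[OF _ \<rho>] in \<open>simp add: inner_cis cos_sin_thirds\<close>)
  then show "o1 \<bullet> cis (\<rho> + 2 * pi / 3) \<ge> 1/2 - cos \<rho> / 2 - (2 - sqrt 3 - \<epsilon>) * sin \<rho>" using o(2) opp by simp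
  have "Complex (1/4 + \<phi> * sqrt 3 / 2) (- sqrt 3 / 4 + \<phi> / 2) \<bullet> cis (\<rho> + 5 * pi / 3) = cos \<rho> / 2 + \<phi> * sin \<rho>"
    unfolding inner_cis cos_sin_thirds by (simp add: field_simps)
  then show "o1 \<bullet> cis (\<rho> + 2 * pi / 3) \<le> 1/2 - cos \<rho> / 2 - \<phi> * sin \<rho>"
    using o(2) opp support_fun_ge[OF K DE, of "\<rho> + 5 * pi / 3"] by simp
  have "Complex (- 1/4 + \<gamma> * sqrt 3 / 2) (- sqrt 3 / 4 - \<gamma> / 2) \<bullet> cis (\<rho> + 4 * pi / 3) = cos \<rho> / 2 + \<gamma> * sin \<rho>"
    unfolding inner_cis cos_sin_thirds by (simp add: field_simps)
  then show "o1 \<bullet> cis (\<rho> + 4 * pi / 3) \<ge> cos \<rho> / 2 + \<gamma> * sin \<rho> - 1/2"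
    using o(3) support_fun_ge[OF K CD, of "\<rho> + 4 * pi / 3"] by simp
  have "Complex (1/4 + \<gamma> * sqrt 3 / 2) (sqrt 3 / 4 - \<gamma> / 2) \<bullet> cis (\<rho> + pi / 3) = cos \<rho> / 2 - \<gamma> * sin \<rho>"
    unfolding inner_cis cos_sin_thirds by (simp add: field_simps)
  then show "o1 \<bullet> cis (\<rho> + 4 * pi / 3) \<le> 1/2 - cos \<rho> / 2 + \<gamma> * sin \<rho>"
    using o(3) support_fun_ge[OF K FA, of "\<rho> + pi / 3"] support_fun_flip(1)[OF K, of \<rho>] by simp
qed

text \<open>The shift of the centre is known along the normals of the second hexagon, but the extra
  line needs it along a tilted direction; this is the change to the oblique basis formed by two
  normals.\<close>

lemma tilt_combination:
  "(cos tilt + sin tilt * sqrt 3 / 3) * (p \<bullet> cis t) + (2 * sin tilt * sqrt 3 / 3) * (p \<bullet> cis (t + 2 * pi / 3))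
     = p \<bullet> cis (t + tilt)" (is ?A)
  "(cos tilt + sin tilt * sqrt 3 / 3) * (p \<bullet> cis t) + (2 * sin tilt * sqrt 3 / 3) * (p \<bullet> cis (t + 4 * pi / 3))
     = p \<bullet> cis (t - tilt)" (is ?B)
proof -
  have 3: "sqrt 3 * (sqrt 3 * x) = 3 * x" for x :: real by simp
  show ?A ?B
    unfolding inner_cis cos_sin_thirds cos_add[of t tilt] sin_add[of t tilt] cos_diff[of t tilt] sin_diff[of t tilt]
    by (simp_all add: field_simps 3)
qed

text \<open>After a rotation by an odd multiple of pi / 3, one of the two tip directions of the
  second hexagon falls close to the normal of \<open>BC\<close> (for \<open>m = 1\<close>) or of
  \<open>DE\<close> (for \<open>m = 3\<close> and \<open>m = 5\<close>). There the first hexagon and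
  its contact points leave no room for a violating point.\<close>

lemma opposite_label_far:
  assumes bad: "bad_frame K" and \<rho>: "0 \<le> \<rho>" "\<rho> < tilt"
    and o: "o1 \<bullet> cis \<rho> = support_fun K \<rho> - 1/2"
      "o1 \<bullet> cis (\<rho> + 2 * pi / 3) = support_fun K (\<rho> + 2 * pi / 3) - 1/2"
      "o1 \<bullet> cis (\<rho> + 4 * pi / 3) = support_fun K (\<rho> + 4 * pi / 3) - 1/2"
    and m: "m = 1 \<or> m = 3 \<or> m = (5::int)"
    and x: "x \<in> K" "(x - o1) \<bullet> cis (\<rho> + m * pi / 3 + (2 * pi / 3 - tilt)) > 5223061/10000000"
    and y: "y \<in> K" "(y - o1) \<bullet> cis (\<rho> + m * pi / 3 + tilt) > 5223061/10000000"
  shows False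
proof -
  have std: "std_frame K" using bad by (simp add: bad_frame_def)
  obtain \<epsilon> \<phi> \<gamma> where hb: "hexagonal_body K \<epsilon> \<phi> \<gamma>" by (rule std_frame_contacts[OF std])
  interpret hexagonal_body K \<epsilon> \<phi> \<gamma> by fact
  note off = bad_frame_offsets[OF bad hb]
  have g: "\<gamma> \<ge> -31/1000" "\<gamma> \<le> 31/1000" using off by linarith+
  have pe: "\<phi> \<ge> 105/1000" "\<epsilon> \<ge> 105/1000" using off by linarith+
  define c s where "c = cos \<rho>" and "s = sin \<rho>"
  have tl: "tilt < pi / 2"
  proof (rule ccontr)
    assume "\<not> ?thesis"
    moreover have "tilt < pi" using arctan_ubound[of "139/2000"] by (simp add: tilt_def)
    ultimately have "cos tilt \<le> cos (pi / 2)" by (intro cos_monotone_0_pi_le) auto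
    then show False by (simp add: cos_tilt)
  qed
  have s0: "s \<ge> 0" unfolding s_def using \<rho> tl by (intro sin_ge_zero) auto
  have s1: "s \<le> sin tilt" unfolding s_def using \<rho> tl by (intro sin_monotone_2pi_le) auto
  have c0: "c \<ge> cos tilt" unfolding c_def using \<rho> tl by (intro cos_monotone_0_pi_le) auto
  have c1: "c \<le> 1" "c \<le> 1 - s\<^sup>2 / 2" unfolding c_def s_def using cos_le_quadratic[of \<rho>] by auto
  have d: "sin tilt * c - cos tilt * s = sin (tilt - \<rho>)" "cos tilt * c + sin tilt * s = cos (tilt - \<rho>)"
    by (simp_all add: sin_diff cos_diff c_def s_def)
  have d0: "sin tilt * c - cos tilt * s \<ge> 0" unfolding d using \<rho> tl by (intro sin_ge_zero) auto
  have sm: "sqrt 3 * s \<le> c"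
  proof -
    have "sqrt 3 * s \<le> 2 * s" using sqrt3_bounds s0 by (intro mult_right_mono) auto
    then show ?thesis using s1 c0 by (simp add: sin_tilt cos_tilt)
  qed
  have dm: "sqrt 3 * (sin tilt * c - cos tilt * s) \<le> cos tilt * c + sin tilt * s"
  proof -
    have "sqrt 3 * (sin tilt * c - cos tilt * s) \<le> 2 * (sin tilt * c - cos tilt * s)"
      using sqrt3_bounds d0 by (intro mult_right_mono) auto
    then show ?thesis using s0 c0 by (simp add: sin_tilt cos_tilt)
  qed
  note f = second_frame_bounds[OF std hb o s0[unfolded s_def] sm[unfolded s_def c_def], folded c_def s_def]
  define f0 where "f0 = o1 \<bullet> cis \<rho>"
  define f1 where "f1 = o1 \<bullet> cis (\<rho> + 2 * pi / 3)"
  define f2 where "f2 = o1 \<bullet> cis (\<rho> + 4 * pi / 3)"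
  note f = f[folded f0_def f1_def f2_def]
  note m
  moreover have False if m: "m = 1"
  proof -
    have e: "\<rho> + real_of_int m * pi / 3 + (2 * pi / 3 - tilt) = \<rho> - tilt + pi" using m by (simp add: field_simps)
    have "(x - o1) \<bullet> cis (\<rho> + m * pi / 3 + (2 * pi / 3 - tilt)) = - (x \<bullet> cis (\<rho> - tilt)) + o1 \<bullet> cis (\<rho> - tilt)"
      unfolding e cis_add_pi by (simp add: inner_diff_left)
    also have "o1 \<bullet> cis (\<rho> - tilt) = (cos tilt + sin tilt * sqrt 3 / 3) * f0 + (2 * sin tilt * sqrt 3 / 3) * f2"
      unfolding f0_def f2_def by (rule tilt_combination(2)[symmetric])
    also have "- (x \<bullet> cis (\<rho> - tilt)) = - Re x * (cos tilt * c + sin tilt * s) + Im x * (sin tilt * c - cos tilt * s)"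
      by (simp add: inner_cis cos_diff sin_diff c_def s_def algebra_simps)
    finally show False
      using x(2) opposite_label_1[OF off(3,4,1) s0 c1(2) dm d0 f(1,3,5) x(1)] by linarith
  qed
  moreover have False if m: "m = 3"
  proof -
    have e: "\<rho> + real_of_int m * pi / 3 + (2 * pi / 3 - tilt) = \<rho> + 2 * pi / 3 - tilt + pi" using m by (simp add: field_simps)
    obtain x' where x': "x' \<in> K" "x' \<bullet> cis (2 * pi / 3 - tilt) > 5223061/10000000"
      using bad by (auto simp: bad_frame_def)
    have cs0: "cos (2 * pi / 3) = - 1/2" "sin (2 * pi / 3) = sqrt 3 / 2" using cos_sin_thirds[of 0] by simp_all
    have x'': "Re x' * (sqrt 3 / 2 * sin tilt - cos tilt / 2) + Im x' * (sqrt 3 / 2 * cos tilt + sin tilt / 2) > 5223061/10000000"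
      using x'(2) unfolding inner_cis cos_diff sin_diff cs0 by (simp add: algebra_simps)
    have "(x - o1) \<bullet> cis (\<rho> + m * pi / 3 + (2 * pi / 3 - tilt))
        = - (x \<bullet> cis (\<rho> + 2 * pi / 3 - tilt)) + o1 \<bullet> cis (\<rho> + 2 * pi / 3 - tilt)"
      unfolding e cis_add_pi by (simp add: inner_diff_left)
    also have "o1 \<bullet> cis (\<rho> + 2 * pi / 3 - tilt) = (cos tilt + sin tilt * sqrt 3 / 3) * f1 + (2 * sin tilt * sqrt 3 / 3) * f0"
    proof -
      have "\<rho> + 2 * pi / 3 + 4 * pi / 3 = \<rho> + 2 * pi" by simp
      moreover have "cis (\<rho> + 2 * pi) = cis \<rho>" by (simp flip: cis_mult)
      ultimately have "cis (\<rho> + 2 * pi / 3 + 4 * pi / 3) = cis \<rho>" by metis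
      then show ?thesis unfolding f0_def f1_def
        using tilt_combination(2)[of o1 "\<rho> + 2 * pi / 3"] by simp
    qed
    finally have eq: "(x - o1) \<bullet> cis (\<rho> + m * pi / 3 + (2 * pi / 3 - tilt)) = - (x \<bullet> cis (\<rho> + 2 * pi / 3 - tilt))
        + ((cos tilt + sin tilt * sqrt 3 / 3) * f1 + (2 * sin tilt * sqrt 3 / 3) * f0)" .
    have n: "cos tilt * cos tilt + sin tilt * sin tilt = 1" by (metis power2_eq_square sin_cos_squared_add2)
    have "sin tilt * - (x \<bullet> cis (\<rho> + 2 * pi / 3 - tilt)) = s * (Re x / 2 - sqrt 3 / 2 * Im x) +
        (sin tilt * c - cos tilt * s) * (- Re x * (sqrt 3 / 2 * sin tilt - cos tilt / 2) - Im x * (sqrt 3 / 2 * cos tilt + sin tilt / 2))"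
    proof -
      have n': "sin tilt * (sin tilt * r) = r - cos tilt * (cos tilt * r)" for r
      proof -
        have "(cos tilt * cos tilt + sin tilt * sin tilt) * r = r" by (metis n mult_1)
        then have "cos tilt * (cos tilt * r) + sin tilt * (sin tilt * r) = r" by (simp only: distrib_right mult.assoc)
        then show ?thesis by linarith
      qed
      have cs: "cos (\<rho> + 2 * pi / 3 - tilt) = (- c / 2 - sqrt 3 / 2 * s) * cos tilt + (- s / 2 + sqrt 3 / 2 * c) * sin tilt"
        "sin (\<rho> + 2 * pi / 3 - tilt) = (- s / 2 + sqrt 3 / 2 * c) * cos tilt - (- c / 2 - sqrt 3 / 2 * s) * sin tilt"
        unfolding cos_diff sin_diff cos_sin_thirds c_def s_def by simp_all
      show ?thesis unfolding inner_cis cs by (simp add: field_simps n')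
    qed
    then have "sin tilt * ((x - o1) \<bullet> cis (\<rho> + m * pi / 3 + (2 * pi / 3 - tilt))) \<le> sin tilt * (5223061/10000000)"
      unfolding eq distrib_left[of "sin tilt" "- (x \<bullet> cis (\<rho> + 2 * pi / 3 - tilt))"]
      using opposite_label_3[OF pe(1) _ s0 c1(1) c0 s1 d0 f(4,2) x'(1) x'' x(1)] off(1) by simp
    then show False using x(2) by (simp add: sin_tilt)
  qed
  moreover have False if m: "m = 5"
  proof -
    have e: "\<rho> + real_of_int m * pi / 3 + tilt = \<rho> + tilt + 5 * pi / 3"
      "\<rho> + tilt + 5 * pi / 3 = \<rho> + 2 * pi / 3 + tilt + pi" using m by (simp_all add: field_simps)
    have "(y - o1) \<bullet> cis (\<rho> + m * pi / 3 + tilt) = y \<bullet> cis (\<rho> + tilt + 5 * pi / 3) + o1 \<bullet> cis (\<rho> + 2 * pi / 3 + tilt)"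
    proof -
      have c: "cis (\<rho> + tilt + 5 * pi / 3) = - cis (\<rho> + 2 * pi / 3 + tilt)" unfolding e(2) by (rule cis_add_pi)
      show ?thesis unfolding e(1) inner_diff_left c by simp
    qed
    also have "o1 \<bullet> cis (\<rho> + 2 * pi / 3 + tilt) = (cos tilt + sin tilt * sqrt 3 / 3) * f1 + (2 * sin tilt * sqrt 3 / 3) * f2"
    proof -
      have e: "\<rho> + 2 * pi / 3 + 2 * pi / 3 = \<rho> + 4 * pi / 3" by simp
      show ?thesis unfolding f1_def f2_def
        using tilt_combination(1)[of o1 "\<rho> + 2 * pi / 3", symmetric] unfolding e .
    qed
    also have "y \<bullet> cis (\<rho> + tilt + 5 * pi / 3) = Re y * ((cos tilt * c - sin tilt * s) / 2 + sqrt 3 / 2 * (sin tilt * c + cos tilt * s))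
      + Im y * ((sin tilt * c + cos tilt * s) / 2 - sqrt 3 / 2 * (cos tilt * c - sin tilt * s))"
      unfolding inner_cis cos_sin_thirds unfolding cos_add sin_add c_def s_def by (simp add: algebra_simps)
    finally show False
      using y(2) opposite_label_5[OF pe g(2) s0 c1(1) c0 s1 f(4,6) y(1)] by linarith
  qed
  ultimately show False by blast
qed

section \<open>The covering polygon\<close>

text \<open>The vertices are scaled by \<open>10 ^ 10\<close> and listed counterclockwise; the first one is repeated at the end.\<close>

definition cover_vertices :: "(real \<times> real) list" where
  "cover_vertices = [(5000000020, -1265000585), (5000000020, 2886751357), (1363530374, 4986268086),
     (1281195528, 5032771666), (1198424670, 5078494606), (1115225053, 5123432898),
     (1031604318, 5167582413), (947569885, 5210939239), (863129123, 5253499570),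
     (778289706, 5295259537), (693059263, 5336215386), (607445371, 5376363477),
     (521455648, 5415700238), (435097752, 5454222164), (348379470, 5491925780),
     (261308632, 5528807684), (173892924, 5564864621), (86140166, 5600093365),
     (-1830781, 5634447413), (-619196174, 5384405336), (-706672095, 5341693393),
     (-795299927, 5297325852), (-883483678, 5252082093), (-971214615, 5205966601),
     (-1058484143, 5158983894), (-1145283801, 5111138529), (-1231605001, 5062435236),
     (-5000000020, 2886751357), (-5000000020, -1415054245), (-3595522652, -3697626744),
     (0, -5773502715), (3725472934, -3622599914), (5000000020, -1265000585)]"

definition cross :: "real \<times> real \<Rightarrow> real \<times> real \<Rightarrow> real" where
  "cross p q = fst p * snd q - snd p * fst q"

text \<open>With counterclockwise vertices the interior is to the left of every edge. The edge
  normals carry the scale factor once and \<open>cross p q\<close> carries it twice, which explains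
  the division.\<close>

definition cover_region :: "(real \<times> real) set" where
  "cover_region = {x. \<forall>(p, q) \<in> set (zip cover_vertices (tl cover_vertices)).
     (snd q - snd p) * fst x - (fst q - fst p) * snd x \<le> cross p q / 10000000000}"

context hexagonal_body
begin

text \<open>A form of \<open>disc\<close> for integer edge normals: \<open>N\<close> overestimates
  their length, so no square root has to be evaluated.\<close>

lemma disc_scaled:
  assumes "p \<in> K" "z \<in> K" and N: "a * a + b * b \<le> N * N" "N \<ge> 0"
  shows "a * Re z + b * Im z \<le> N + a * Re p + b * Im p"
proof -
  have "(z - p) \<bullet> Complex a b \<le> norm (z - p) * norm (Complex a b)" by (rule norm_cauchy_schwarz)
  also have "norm (Complex a b) \<le> N"
    unfolding cmod_def using N by (intro real_le_lsqrt) (simp_all add: power2_eq_square)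
  then have "norm (z - p) * norm (Complex a b) \<le> 1 * N"
    using dist_le[OF assms(2,1)] by (intro mult_mono) (auto simp: dist_norm)
  finally show ?thesis by (simp add: inner_complex_def algebra_simps)
qed

text \<open>The bound from the disc about the contact point on \<open>DE\<close> increases with
  \<phi>, so the largest \<phi> is the worst case. For given numerals the conditions on
  \<open>a\<close>, \<open>b\<close>, \<open>N\<close> and \<open>d\<close> are rational
  comparisons.\<close>

lemma left_edge:
  assumes z: "z \<in> K" and \<phi>: "\<phi> \<le> 141506/1000000"
    and N: "a * a + b * b \<le> N * N" "N \<ge> 0" and ab: "0 \<le> b" "- b \<le> (17320508076/10000000000) * a"
    "a * (141506/1000000) / 2 \<le> b / 4" "a \<le> 0"
    and d: "N + a / 4 + (141506/1000000) * b / 2 + (17320508075/10000000000) * (a * (141506/1000000) / 2 - b / 4) \<le> d"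
  shows "a * Re z + b * Im z \<le> d"
proof -
  have "a * Re z + b * Im z \<le> N + a * (1/4 + \<phi> * sqrt 3 / 2) + b * (- sqrt 3 / 4 + \<phi> / 2)"
    using disc_scaled[OF DE z N] by simp
  also have "\<dots> = N + a / 4 - sqrt 3 * b / 4 + \<phi> * ((sqrt 3 * a + b) / 2)" by (simp add: field_simps)
  also have "\<dots> \<le> N + a / 4 - sqrt 3 * b / 4 + (141506/1000000) * ((sqrt 3 * a + b) / 2)"
  proof (intro add_left_mono mult_right_mono \<phi>)
    have "(17320508076/10000000000) * a \<le> sqrt 3 * a" using ab(4) sqrt3_bounds by (intro mult_right_mono_neg) auto
    then have "- b \<le> sqrt 3 * a" by (rule order_trans[OF ab(2)])
    then show "0 \<le> (sqrt 3 * a + b) / 2" by simp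
  qed
  also have "\<dots> = N + a / 4 + (141506/1000000) * b / 2 + sqrt 3 * (a * (141506/1000000) / 2 - b / 4)"
    by (simp add: field_simps)
  also have "\<dots> \<le> N + a / 4 + (141506/1000000) * b / 2 + (17320508075/10000000000) * (a * (141506/1000000) / 2 - b / 4)"
    using ab(3) sqrt3_bounds by (intro add_left_mono mult_right_mono_neg) auto
  finally show ?thesis using d by simp
qed

text \<open>The counterpart of \<open>left_edge\<close> with the disc about the contact point on
  \<open>CD\<close>, whose bound increases with \<open>- \<gamma>\<close>.\<close>

lemma right_edge:
  assumes z: "z \<in> K" and \<gamma>: "- \<gamma> \<le> 1265002/10000000"
    and N: "a * a + b * b \<le> N * N" "N \<ge> 0" and ab: "0 \<le> b" "0 \<le> a" "(17320508076/10000000000) * a \<le> b"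
    and d: "N - a / 4 + (1265002/10000000) * b / 2 - (17320508075/10000000000) * (a * (1265002/10000000) / 2 + b / 4) \<le> d"
  shows "a * Re z + b * Im z \<le> d"
proof -
  have "a * Re z + b * Im z \<le> N + a * (- 1/4 + \<gamma> * sqrt 3 / 2) + b * (- sqrt 3 / 4 - \<gamma> / 2)"
    using disc_scaled[OF CD z N] by simp
  also have "\<dots> = N - a / 4 - sqrt 3 * b / 4 + (- \<gamma>) * ((b - sqrt 3 * a) / 2)" by (simp add: field_simps)
  also have "\<dots> \<le> N - a / 4 - sqrt 3 * b / 4 + (1265002/10000000) * ((b - sqrt 3 * a) / 2)"
  proof (intro add_left_mono mult_right_mono \<gamma>)
    have "sqrt 3 * a \<le> (17320508076/10000000000) * a" using ab(2) sqrt3_bounds by (intro mult_right_mono) auto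
    then have "sqrt 3 * a \<le> b" by (rule order_trans[OF _ ab(3)])
    then show "0 \<le> (b - sqrt 3 * a) / 2" by simp
  qed
  also have "\<dots> = N - a / 4 + (1265002/10000000) * b / 2 - sqrt 3 * (a * (1265002/10000000) / 2 + b / 4)"
    by (simp add: field_simps)
  also have "\<dots> \<le> N - a / 4 + (1265002/10000000) * b / 2 - (17320508075/10000000000) * (a * (1265002/10000000) / 2 + b / 4)"
    using ab sqrt3_bounds by (intro diff_left_mono mult_right_mono) auto
  finally show ?thesis using d by simp
qed

lemma coordinate_bounds:
  assumes "z \<in> K"
  shows "\<bar>Re z\<bar> \<le> 1" "\<bar>Im z\<bar> \<le> 1"
proof -
  show "\<bar>Re z\<bar> \<le> 1" using in_hexagon(1,2)[OF assms] by linarith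
  have "\<bar>sqrt 3 * Im z\<bar> \<le> 3/2" using in_hexagon[OF assms] by linarith
  then have "sqrt 3 * \<bar>Im z\<bar> \<le> 3/2" by (simp add: abs_mult)
  moreover have "(3/2) * \<bar>Im z\<bar> \<le> sqrt 3 * \<bar>Im z\<bar>" using sqrt3_bounds by (intro mult_right_mono) auto
  ultimately show "\<bar>Im z\<bar> \<le> 1" by linarith
qed

lemma in_cover_region:
  assumes z: "z \<in> K" and \<phi>: "\<phi> \<le> 141506/1000000" and \<gamma>: "- \<gamma> \<le> 1265002/10000000"
    and E: "z \<bullet> cis (11 * pi / 6 + slant) \<le> 1/2" and C: "z \<bullet> cis (7 * pi / 6 + slant) \<le> 1/2"
    and H: "z \<bullet> cis (2 * pi / 3 - tilt) \<le> 5223061/10000000"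
  shows "(Re z, Im z) \<in> cover_region"
proof -
  define X Y where "X = Re z" and "Y = Im z"
  define U W where "U = sqrt 3 * X" and "W = sqrt 3 * Y"
  have cs0: "cos (2 * pi / 3) = - 1/2" "sin (2 * pi / 3) = sqrt 3 / 2" using cos_sin_thirds[of 0] by simp_all
  have near: "U \<le> 17320508076/10000000000 * X + 1/10000000000" "U \<ge> 17320508076/10000000000 * X - 1/10000000000"
    "W \<le> 17320508076/10000000000 * Y + 1/10000000000" "W \<ge> 17320508076/10000000000 * Y - 1/10000000000"
    unfolding U_def W_def X_def Y_def using coordinate_bounds[OF z] sqrt3_bounds
    by (intro mult_near; simp add: abs_le_iff)+
  have hex: "X \<le> 1/2" "- X \<le> 1/2" "X + W \<le> 1" "- X + W \<le> 1" "- X - W \<le> 1" "X - W \<le> 1"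
    using in_hexagon[OF z] by (simp_all add: X_def Y_def W_def)
  have E': "(U * 249951 + X * 7000 + W * 7000 - Y * 249951) \<le> 250049"
    using E unfolding inner_cis cos_sin_sixths cos_slant sin_slant X_def[symmetric] Y_def[symmetric] U_def W_def
    by (simp add: field_simps)
  have C': "(X * 7000 - U * 249951 - Y * 249951 - W * 7000) \<le> 250049"
    using C unfolding inner_cis cos_sin_sixths cos_slant sin_slant X_def[symmetric] Y_def[symmetric] U_def W_def
    by (simp add: field_simps)
  have H': "(- X * 3980679 + U * 556000 + W * 3980679 + Y * 556000) \<le> 2 * 4019321 * (5223061/10000000)"
    using H unfolding inner_cis cos_diff sin_diff cs0 cos_tilt sin_tilt X_def[symmetric] Y_def[symmetric] U_def W_def
    by (simp add: field_simps)
  note left = left_edge[OF z \<phi>, folded X_def Y_def]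
  note right = right_edge[OF z \<gamma>, folded X_def Y_def]
  \<comment> \<open>The hexagon sides are \<open>e0\<close>, \<open>e1\<close>, \<open>e26\<close>,
    \<open>e27\<close>, \<open>e29\<close>, \<open>e30\<close>; \<open>e28\<close> and
    \<open>e31\<close> are the cuts at C and E, and \<open>e18\<close> is the extra line. The
    remaining edges bound from outside the circular arcs about the extremal contact points on
    \<open>CD\<close> (\<open>e2\<close> to \<open>e17\<close>) and on \<open>DE\<close>
    (\<open>e19\<close> to \<open>e25\<close>). The polygon is slightly enlarged to leave slack for
    the estimates of \<open>sqrt 3\<close>.\<close>
  have e0: "(4151751942) * X + (0) * Y \<le> 20758759793035038840 / 10000000000"
    using hex near hex by argo
  have e1: "(2099516729) * X + (3636469646) * Y \<le> 20995167372270144202 / 10000000000"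
    using hex near hex by argo
  have e2: "(46503580) * X + (82334846) * Y \<le> 473952658805263676 / 10000000000"
    by (rule right[where N = "94560085759 / 1000"]) simp_all
  have e3: "(45722940) * X + (82770858) * Y \<le> 475146855167921748 / 10000000000"
    by (rule right[where N = "94560045349 / 1000"]) simp_all
  have e4: "(44938292) * X + (83199617) * Y \<le> 476383963916229542 / 10000000000"
    by (rule right[where N = "94560173207 / 1000"]) simp_all
  have e5: "(44149515) * X + (83620735) * Y \<le> 477661869859739325 / 10000000000"
    by (rule right[where N = "94560070837 / 1000"]) simp_all
  have e6: "(43356826) * X + (84034433) * Y \<le> 478981946973601497 / 10000000000"
    by (rule right[where N = "94560035377 / 1000"]) simp_all
  have e7: "(42560331) * X + (84440762) * Y \<le> 480344568028092053 / 10000000000"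
    by (rule right[where N = "94560161073 / 1000"]) simp_all
  have e8: "(41759967) * X + (84839417) * Y \<le> 481748084421769631 / 10000000000"
    by (rule right[where N = "94560147635 / 1000"]) simp_all
  have e9: "(40955849) * X + (85230443) * Y \<le> 483192831815675285 / 10000000000"
    by (rule right[where N = "94560086619 / 1000"]) simp_all
  have e10: "(40148091) * X + (85613892) * Y \<le> 484679174105059245 / 10000000000"
    by (rule right[where N = "94560074632 / 1000"]) simp_all
  have e11: "(39336761) * X + (85989723) * Y \<le> 486206939514130202 / 10000000000"
    by (rule right[where N = "94560103784 / 1000"]) simp_all
  have e12: "(38521926) * X + (86357896) * Y \<le> 487775953804917296 / 10000000000"
    by (rule right[where N = "94560165949 / 1000"]) simp_all
  have e13: "(37703616) * X + (86718282) * Y \<le> 489385534272273480 / 10000000000"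
    by (rule right[where N = "94560155946 / 1000"]) simp_all
  have e14: "(36881904) * X + (87070838) * Y \<le> 491035478066514520 / 10000000000"
    by (rule right[where N = "94560063837 / 1000"]) simp_all
  have e15: "(36056937) * X + (87415708) * Y \<le> 492726626974280456 / 10000000000"
    by (rule right[where N = "94560079902 / 1000"]) simp_all
  have e16: "(35228744) * X + (87752758) * Y \<le> 494458247692382174 / 10000000000"
    by (rule right[where N = "94560091691 / 1000"]) simp_all
  have e17: "(34354048) * X + (87970947) * Y \<le> 495604780004958623 / 10000000000"
    by (rule right[where N = "94440924022 / 1000"]) simp_all
  have e18: "(-250042077) * X + (617365393) * Y \<le> 3478970613748350446 / 10000000000"
    using H' near hex by argo
  have e19: "(-42711943) * X + (87475921) * Y \<le> 497452887493620538 / 10000000000"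
    by (rule left[where N = "97346529623 / 1000"]) simp_all
  have e20: "(-44367541) * X + (88627832) * Y \<le> 504776007778782371 / 10000000000"
    by (rule left[where N = "99112921960 / 1000"]) simp_all
  have e21: "(-45243759) * X + (88183751) * Y \<le> 503120422128536445 / 10000000000"
    by (rule left[where N = "99112923824 / 1000"]) simp_all
  have e22: "(-46115492) * X + (87730937) * Y \<le> 501512367704750717 / 10000000000"
    by (rule left[where N = "99112844321 / 1000"]) simp_all
  have e23: "(-46982707) * X + (87269528) * Y \<le> 499952539743697133 / 10000000000"
    by (rule left[where N = "99112790670 / 1000"]) simp_all
  have e24: "(-47845365) * X + (86799658) * Y \<le> 498441597795255447 / 10000000000"
    by (rule left[where N = "99112862843 / 1000"]) simp_all
  have e25: "(-48703293) * X + (86321200) * Y \<le> 496978703717771493 / 10000000000"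
    by (rule left[where N = "99112866564 / 1000"]) simp_all
  have e26: "(-2175683879) * X + (3768395019) * Y \<le> 21756838873323968363 / 10000000000"
    using hex near hex by argo
  have e27: "(-4301805602) * X + (0) * Y \<le> 21509028096036112040 / 10000000000"
    using hex near hex by argo
  have e28: "(-2282572499) * X + (-1404477368) * Y \<le> 13400274202246277140 / 10000000000"
    using C' near hex by argo
  have e29: "(-2075875971) * X + (-3595522652) * Y \<le> 20758759793166000180 / 10000000000"
    using hex near hex by argo
  have e30: "(2150902801) * X + (-3725472934) * Y \<le> 21509028099108015810 / 10000000000"
    using hex near hex by argo
  have e31: "(2357599329) * X + (-1274527086) * Y \<le> 13400274201540331890 / 10000000000"
    using E' near hex by argo
  show ?thesis
    unfolding cover_region_def X_def[symmetric] Y_def[symmetric]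
    using e0 e1 e2 e3 e4 e5 e6 e7 e8 e9 e10 e11 e12 e13 e14 e15 e16 e17 e18 e19 e20 e21 e22 e23 e24 e25 e26 e27 e28 e29 e30 e31
    by (simp add: cover_vertices_def cross_def algebra_simps)
qed

end

section \<open>Placing a body of constant width\<close>

definition coverable :: "complex set \<Rightarrow> bool" where
  "coverable K \<longleftrightarrow> (\<exists>f. (\<forall>x y. dist (f x) (f y) = dist x y) \<and> (\<forall>x\<in>K. (Re (f x), Im (f x)) \<in> cover_region))"

lemma coverable_image:
  assumes "coverable (g ` K)" "\<And>x y. dist (g x) (g y) = dist x y"
  shows "coverable K"
proof -
  from assms(1) obtain f where "\<forall>x y. dist (f x) (f y) = dist x y"
    "\<forall>x\<in>g ` K. (Re (f x), Im (f x)) \<in> cover_region" by (auto simp: coverable_def)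
  then show ?thesis unfolding coverable_def using assms(2) by (intro exI[of _ "f \<circ> g"]) auto
qed

lemma coverable_if_cuts:
  assumes std: "std_frame K"
    and E: "support_fun K (11 * pi / 6 + slant) \<le> 1/2" and C: "support_fun K (7 * pi / 6 + slant) \<le> 1/2"
    and H: "\<And>x. x \<in> K \<Longrightarrow> x \<bullet> cis (2 * pi / 3 - tilt) \<le> 5223061/10000000"
  shows "coverable K"
proof -
  note K = std_frameD(1)[OF std]
  obtain \<epsilon> \<phi> \<gamma> where hb: "hexagonal_body K \<epsilon> \<phi> \<gamma>" by (rule std_frame_contacts[OF std])
  interpret hexagonal_body K \<epsilon> \<phi> \<gamma> by fact
  have "(Re z, Im z) \<in> cover_region" if "z \<in> K" for z
    using offset_le_of_cut[OF hb K] E C H[OF that] that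
      order_trans[OF support_fun_ge[OF K that] E] order_trans[OF support_fun_ge[OF K that] C]
    by (intro in_cover_region) auto
  then show ?thesis unfolding coverable_def by (intro exI[of _ id]) auto
qed

text \<open>In the direction of the extra line the disc about the contact point on \<open>DE\<close>
  reaches as far as \<open>1 - cos tilt / 2 + \<phi> * sin tilt\<close>. At \<phi> = 0.1265002 this
  is about 0.52230603, and the distance 0.5223061 of the line is that value rounded up.\<close>

lemma tip_bound_if_offset:
  assumes std: "std_frame K" and E: "support_fun K (11 * pi / 6 - slant) \<le> 1/2" and x: "x \<in> K"
  shows "x \<bullet> cis (2 * pi / 3 - tilt) \<le> 5223061/10000000"
proof -
  note K = std_frameD(1)[OF std]
  obtain \<epsilon> \<phi> \<gamma> where hb: "hexagonal_body K \<epsilon> \<phi> \<gamma>" by (rule std_frame_contacts[OF std])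
  interpret hexagonal_body K \<epsilon> \<phi> \<gamma> by fact
  have cs0: "cos (2 * pi / 3) = - 1/2" "sin (2 * pi / 3) = sqrt 3 / 2" using cos_sin_thirds[of 0] by simp_all
  have \<phi>: "\<phi> \<le> 1265002/10000000" by (rule offset_le_of_cut(2)[OF hb K E])
  have "x \<bullet> cis (2 * pi / 3 - tilt) \<le> 1 + Complex (1/4 + \<phi> * sqrt 3 / 2) (- sqrt 3 / 4 + \<phi> / 2) \<bullet> cis (2 * pi / 3 - tilt)"
    using disc_cis[OF DE x, of "2 * pi / 3 - tilt"] by (simp add: inner_cis algebra_simps)
  also have "Complex (1/4 + \<phi> * sqrt 3 / 2) (- sqrt 3 / 4 + \<phi> / 2) \<bullet> cis (2 * pi / 3 - tilt) = - cos tilt / 2 + \<phi> * sin tilt"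
    unfolding inner_cis cos_diff sin_diff cs0 by (simp add: field_simps)
  finally show ?thesis using \<phi> unfolding cos_tilt sin_tilt by argo
qed

text \<open>The direction of the extra line lies between the normals of the cut at A and of the side
  \<open>AB\<close>, so the point where these two lines meet is the worst case.\<close>

lemma tip_bound_if_cap:
  assumes std: "std_frame K" and A: "support_fun K (pi / 2 - slant) \<le> 1/2" and x: "x \<in> K"
  shows "x \<bullet> cis (2 * pi / 3 - tilt) \<le> 5223061/10000000"
proof -
  note K = std_frameD(1)[OF std]
  obtain \<epsilon> \<phi> \<gamma> where hb: "hexagonal_body K \<epsilon> \<phi> \<gamma>" by (rule std_frame_contacts[OF std])
  interpret hexagonal_body K \<epsilon> \<phi> \<gamma> by fact
  have cs0: "cos (2 * pi / 3) = - 1/2" "sin (2 * pi / 3) = sqrt 3 / 2" using cos_sin_thirds[of 0] by simp_all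
  have 1: "Re x * 7000 + Im x * 249951 \<le> 250049 / 2"
    using order_trans[OF support_fun_ge[OF K x] A] unfolding inner_cis cos_diff sin_diff by (simp add: cos_slant sin_slant field_simps)
  have 2: "- Re x + sqrt 3 * Im x \<le> 1" by (rule in_hexagon(4)[OF x])
  have 3: "\<bar>Re x\<bar> \<le> 1" "\<bar>Im x\<bar> \<le> 1" by (rule coordinate_bounds[OF x])+
  have 4: "sqrt 3 * Im x \<ge> 17320508/10000000 * Im x - 1/10000000" "sqrt 3 * Im x \<le> 17320508/10000000 * Im x + 1/10000000"
    "sqrt 3 * Re x \<le> 17320508/10000000 * Re x + 1/10000000"
    using 3 sqrt3_bounds by (intro mult_near; simp add: abs_le_iff)+
  have "x \<bullet> cis (2 * pi / 3 - tilt) = (- Re x * cos tilt + (sqrt 3 * Re x) * sin tilt + (sqrt 3 * Im x) * cos tilt + Im x * sin tilt) / 2"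
    unfolding inner_cis cos_diff sin_diff cs0 by (simp add: field_simps)
  then show ?thesis using 1 2 3 4 unfolding cos_tilt sin_tilt abs_le_iff by argo
qed

lemma std_frame_rotate:
  assumes std: "std_frame K"
  shows "std_frame (rigid_move (of_int k * pi / 3) 0 ` K)"
proof -
  note K = std_frameD(1)[OF std]
  have "support_fun (rigid_move (of_int k * pi / 3) 0 ` K) (of_int j * pi / 3) = 1/2" for j
  proof -
    have "of_int j * pi / 3 + of_int k * pi / 3 = of_int (j + k) * pi / 3" by (simp add: field_simps)
    then have "support_fun K (of_int j * pi / 3 + of_int k * pi / 3) = 1/2"
      using std_frameD(2)[OF std, of "j + k"] by metis
    then show ?thesis unfolding support_fun_rigid_move[OF K] by simp
  qed
  then show ?thesis using unit_width_rigid_move[OF K] by (simp add: std_frame_def)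
qed

text \<open>Failure of the placement yields a violating point. By the two tip bounds it rules out
  the cuts near E and A with reversed slant, so by constant width the opposite ones near B and D
  miss the body. These are the cuts of the mirror image, whose failure yields the second violating
  point.\<close>

lemma std_frame_coverable_or_bad:
  assumes std: "std_frame K" and not: "\<not> coverable K"
  shows "\<exists>k::int. bad_frame (rigid_move (of_int k * pi / 3) 0 ` K)"
proof -
  note K = std_frameD(1)[OF std]
  define P where "P k \<longleftrightarrow> support_fun K (pi / 6 + slant + of_int k * pi / 3) \<le> 1/2" for k :: int
  have P3: "P k \<or> P (k + 3)" for k
  proof -
    have e: "pi / 6 + slant + of_int (k + 3) * pi / 3 = pi / 6 + slant + of_int k * pi / 3 + pi" by (simp add: field_simps)
    show ?thesis unfolding P_def e support_fun_opposite[OF K] by linarith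
  qed
  have P6: "P (k + 6) \<longleftrightarrow> P k" for k
  proof -
    have "pi / 6 + slant + of_int (k + 6) * pi / 3 = pi / 6 + slant + of_int k * pi / 3 + 2 * pi" by (simp add: field_simps)
    then show ?thesis unfolding P_def by (metis support_fun_periodic)
  qed
  \<comment> \<open>At least one cut of each opposite pair misses the body. One corner chosen from
    each of the three pairs gives either alternate or consecutive corners, so two of them are two
    steps apart; the rotation brings these to C and E.\<close>
  have "\<exists>k. P (k + 3) \<and> P (k + 5)"
  proof -
    have "P (0 + 3) \<and> P (0 + 5) \<or> P (1 + 3) \<and> P (1 + 5) \<or> P (2 + 3) \<and> P (2 + 5) \<or> P (3 + 3) \<and> P (3 + 5) \<or>
        P (4 + 3) \<and> P (4 + 5) \<or> P (5 + 3) \<and> P (5 + 5)"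
      using P3[of 0] P3[of 1] P3[of 2] P6[of 0] P6[of 1] P6[of 2] P6[of 3] P6[of 4] by simp blast
    then show ?thesis by blast
  qed
  then obtain k where k: "P (k + 3)" "P (k + 5)" by blast
  define L where "L = rigid_move (of_int k * pi / 3) 0 ` K"
  have stdL: "std_frame L" unfolding L_def by (rule std_frame_rotate[OF std])
  note L = std_frameD(1)[OF stdL]
  have notL: "\<not> coverable L" using not coverable_image[of "rigid_move (of_int k * pi / 3) 0" K] dist_rigid_move
    by (auto simp: L_def)
  have e: "7 * pi / 6 + slant + of_int k * pi / 3 = pi / 6 + slant + of_int (k + 3) * pi / 3"
    "11 * pi / 6 + slant + of_int k * pi / 3 = pi / 6 + slant + of_int (k + 5) * pi / 3"
    by (simp_all add: field_simps)
  have C: "support_fun L (7 * pi / 6 + slant) \<le> 1/2" and E: "support_fun L (11 * pi / 6 + slant) \<le> 1/2"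
    using k unfolding L_def support_fun_rigid_move[OF K] e P_def by simp_all
  obtain x where x: "x \<in> L" "x \<bullet> cis (2 * pi / 3 - tilt) > 5223061/10000000"
    using coverable_if_cuts[OF stdL E C] notL by force
  have e': "11 * pi / 6 - slant = 5 * pi / 6 - slant + pi" "3 * pi / 2 - slant = pi / 2 - slant + pi" by simp_all
  have "\<not> support_fun L (11 * pi / 6 - slant) \<le> 1/2" using tip_bound_if_offset[OF stdL _ x(1)] x(2) by linarith
  then have B: "support_fun L (5 * pi / 6 - slant) \<le> 1/2"
    unfolding e' support_fun_opposite[OF L] by linarith
  have "\<not> support_fun L (pi / 2 - slant) \<le> 1/2" using tip_bound_if_cap[OF stdL _ x(1)] x(2) by linarith
  then have D: "support_fun L (3 * pi / 2 - slant) \<le> 1/2"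
    unfolding e' support_fun_opposite[OF L] by linarith
  have notM: "\<not> coverable (mirror ` L)" using notL coverable_image[of mirror L] dist_mirror by blast
  have "\<exists>y\<in>L. y \<bullet> cis tilt > 5223061/10000000"
  proof (rule ccontr)
    assume "\<not> ?thesis"
    then have "\<And>x. x \<in> mirror ` L \<Longrightarrow> x \<bullet> cis (2 * pi / 3 - tilt) \<le> 5223061/10000000"
      by (auto simp: inner_mirror not_less)
    with coverable_if_cuts[OF std_frame_mirror[OF stdL]] B D notM show False
      by (simp add: support_fun_mirror_cuts[OF L])
  qed
  then have "bad_frame L" using stdL E C B D x by (auto simp: bad_frame_def)
  then show ?thesis by (auto simp: L_def)
qed

section \<open>Frames at the zeros of \<open>Pal\<close> and their parity\<close>

definition hex_frame :: "complex set \<Rightarrow> real \<Rightarrow> complex set" where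
  "hex_frame K t = rigid_move t (hex_centre K t) ` K"

lemma support_fun_hex_frame:
  "unit_width K \<Longrightarrow> support_fun (hex_frame K t) s = support_fun K (s + t) - hex_centre K t \<bullet> cis (s + t)"
  unfolding hex_frame_def by (rule support_fun_rigid_move)

lemma std_hex_frame:
  assumes K: "unit_width K" and P: "Pal K t = 0"
  shows "std_frame (hex_frame K t)"
proof -
  let ?L = "hex_frame K t"
  have L: "unit_width ?L" unfolding hex_frame_def by (rule unit_width_rigid_move[OF K])
  have e: "0 + t = t" "2 * pi / 3 + t = t + 2 * pi / 3" "4 * pi / 3 + t = t + 4 * pi / 3" by simp_all
  have h: "support_fun ?L 0 = 1/2" "support_fun ?L (2 * pi / 3) = 1/2" "support_fun ?L (4 * pi / 3) = 1/2"
    unfolding support_fun_hex_frame[OF K] e hex_centre_inner[OF P] by simp_all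
  have "4 * pi / 3 = pi / 3 + pi" by simp
  then have h1: "support_fun ?L (pi / 3) = 1/2" using h(3) support_fun_opposite[OF L, of "pi / 3"] by simp
  have nat: "support_fun ?L (real n * pi / 3) = 1/2" for n
  proof (induction n rule: less_induct)
    case (less n)
    show ?case
    proof (cases "n < 3")
      case True
      then have "n = 0 \<or> n = 1 \<or> n = 2" by auto
      then show ?thesis using h h1 by auto
    next
      case False
      then have e: "real n * pi / 3 = real (n - 3) * pi / 3 + pi" by (simp add: field_simps of_nat_diff)
      show ?thesis unfolding e support_fun_opposite[OF L] using less[of "n - 3"] False by simp
    qed
  qed
  have per: "support_fun ?L (s - real n * (2 * pi)) = support_fun ?L s" for s n
  proof (induction n)
    case (Suc n)
    have "s - real (Suc n) * (2 * pi) = s - real n * (2 * pi) - 2 * pi" by (simp add: algebra_simps)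
    then show ?case using Suc support_fun_periodic_minus by metis
  qed simp
  have "support_fun ?L (of_int j * pi / 3) = 1/2" for j
  proof -
    define n where "n = nat \<bar>j\<bar>"
    have "j + 6 * int n \<ge> 0" by (simp add: n_def)
    then obtain m where m: "j + 6 * int n = int m" using nonneg_int_cases by blast
    then have j: "of_int j = real m - 6 * real n" by (metis add_diff_cancel_right' of_int_diff of_int_mult of_int_numeral of_int_of_nat_eq)
    have "of_int j * pi / 3 = real m * pi / 3 - real n * (2 * pi)" unfolding j by (simp add: field_simps)
    then show ?thesis using per nat by metis
  qed
  then show ?thesis using L by (simp add: std_frame_def)
qed

lemma hex_centre_shift_int:
  assumes K: "unit_width K"
  shows "hex_centre K (t + of_int k * pi / 3) = hex_centre K t"
proof (induction k rule: int_induct[of _ 0])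
  case base show ?case by simp
next
  case (step1 i)
  have "t + of_int (i + 1) * pi / 3 = t + of_int i * pi / 3 + pi / 3" by (simp add: field_simps)
  then show ?case using step1 hex_centre_shift[OF K] by metis
next
  case (step2 i)
  have "t + of_int i * pi / 3 = t + of_int (i - 1) * pi / 3 + pi / 3" by (simp add: field_simps)
  then show ?case using step2 hex_centre_shift[OF K] by metis
qed

lemma rigid_move_compose: "rigid_move b 0 (rigid_move a z x) = rigid_move (a + b) z x"
  by (simp add: rigid_move_def cis_mult algebra_simps flip: mult.assoc)

lemma hex_frame_rotate:
  assumes "unit_width K"
  shows "rigid_move (of_int k * pi / 3) 0 ` hex_frame K t = hex_frame K (t + of_int k * pi / 3)"
  unfolding hex_frame_def hex_centre_shift_int[OF assms] image_image rigid_move_compose ..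

lemma Pal_shift_int:
  assumes K: "unit_width K"
  shows "Pal K (t + of_int (2 * j) * pi / 3) = Pal K t"
    "Pal K (t + of_int (2 * j + 1) * pi / 3) = - Pal K t"
proof -
  show *: "Pal K (t + of_int (2 * j) * pi / 3) = Pal K t" for t
  proof (induction j rule: int_induct[of _ 0])
    case base show ?case by simp
  next
    case (step1 i)
    have "t + of_int (2 * (i + 1)) * pi / 3 = t + of_int (2 * i) * pi / 3 + pi / 3 + pi / 3" by (simp add: field_simps)
    then show ?case using step1 Pal_anti[OF K] by (metis minus_minus)
  next
    case (step2 i)
    have "t + of_int (2 * i) * pi / 3 = t + of_int (2 * (i - 1)) * pi / 3 + pi / 3 + pi / 3" by (simp add: field_simps)
    then show ?case using step2 Pal_anti[OF K] by (metis minus_minus)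
  qed
  have "t + of_int (2 * j + 1) * pi / 3 = t + of_int (2 * j) * pi / 3 + pi / 3" by (simp add: field_simps)
  then show "Pal K (t + of_int (2 * j + 1) * pi / 3) = - Pal K t" using Pal_anti[OF K] * by metis
qed

lemma Pal_hex_frame:
  assumes K: "unit_width K"
  shows "Pal (hex_frame K t) s = Pal K (t + s)"
proof -
  have e: "s + t = t + s" "s + 2 * pi / 3 + t = t + s + 2 * pi / 3" "s + 4 * pi / 3 + t = t + s + 4 * pi / 3" by simp_all
  have "z \<bullet> cis r + z \<bullet> cis (r + 2 * pi / 3) + z \<bullet> cis (r + 4 * pi / 3) = 0" for z r
    unfolding inner_cis cos_sin_thirds by (simp add: field_simps)
  from this[of "hex_centre K t" "t + s"] show ?thesis
    unfolding Pal_def support_fun_hex_frame[OF K] e by simp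
qed

definition bad_angle :: "complex set \<Rightarrow> real \<Rightarrow> bool" where
  "bad_angle K t \<longleftrightarrow> Pal K t = 0 \<and> bad_frame (hex_frame K t)"

lemma hex_frame_periodic:
  assumes "unit_width K"
  shows "hex_frame K (t + of_int (6 * j) * pi / 3) = hex_frame K t"
proof -
  have e: "- (t + of_int (6 * j) * pi / 3) = - t + 2 * pi * of_int (- j)" by (simp add: field_simps)
  have "cis (- (t + of_int (6 * j) * pi / 3)) = cis (- t)"
    unfolding e cis_mult[symmetric] by (subst cis_multiple_2pi) simp_all
  then show ?thesis unfolding hex_frame_def hex_centre_shift_int[OF assms] rigid_move_def by simp
qed

lemma bad_angle_periodic:
  assumes "unit_width K"
  shows "bad_angle K (t + of_int (6 * j) * pi / 3) \<longleftrightarrow> bad_angle K t"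
  unfolding bad_angle_def hex_frame_periodic[OF assms] using Pal_shift_int(1)[OF assms, of t "3 * j"] by simp

text \<open>This is \<open>opposite_label_far\<close> in the frame of the first hexagon, where
  \<open>rigid_move t c0 c1\<close> is the centre of the second. A full turn changes no frame, so
  \<open>m\<close> counts only modulo 6.\<close>

lemma odd_bad_angles_far:
  assumes K: "unit_width K" and t: "bad_angle K t" and \<rho>: "0 \<le> \<rho>" "\<rho> < tilt"
    and m: "odd m" and b: "bad_angle K (t + \<rho> + of_int m * pi / 3)"
  shows False
proof -
  define r where "r = m mod 6"
  define \<tau> where "\<tau> = t + \<rho> + of_int r * pi / 3"
  have "m = r + 6 * (m div 6)" by (simp add: r_def)
  then have "t + \<rho> + of_int m * pi / 3 = \<tau> + of_int (6 * (m div 6)) * pi / 3"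
    unfolding \<tau>_def by (metis (no_types, opaque_lifting) add.assoc add_divide_distrib distrib_right of_int_add)
  then have b: "bad_angle K \<tau>" using b bad_angle_periodic[OF K] by metis
  have r: "r = 1 \<or> r = 3 \<or> r = 5" using m unfolding r_def by presburger
  then have r': "r = 2 * (r div 2) + 1" by auto
  define c0 c1 where "c0 = hex_centre K t" and "c1 = hex_centre K (t + \<rho>)"
  have c1: "hex_centre K \<tau> = c1" unfolding \<tau>_def c1_def by (rule hex_centre_shift_int[OF K])
  have "Pal K \<tau> = - Pal K (t + \<rho>)" unfolding \<tau>_def by (subst r', rule Pal_shift_int(2)[OF K])
  then have P: "Pal K (t + \<rho>) = 0" using b by (simp add: bad_angle_def)
  have inner: "(rigid_move t c0 z - rigid_move t c0 c1) \<bullet> cis (\<rho> + r * pi / 3 + s) = rigid_move \<tau> c1 z \<bullet> cis s" for z s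
  proof -
    have e: "\<rho> + r * pi / 3 + s + t = s + \<tau>" by (simp add: \<tau>_def)
    show ?thesis unfolding inner_diff_left inner_rigid_move e by simp
  qed
  obtain x where x: "x \<in> K" "rigid_move \<tau> c1 x \<bullet> cis (2 * pi / 3 - tilt) > 5223061/10000000"
    using b unfolding bad_angle_def bad_frame_def hex_frame_def c1 by blast
  obtain y where y: "y \<in> K" "rigid_move \<tau> c1 y \<bullet> cis tilt > 5223061/10000000"
    using b unfolding bad_angle_def bad_frame_def hex_frame_def c1 by blast
  have e: "\<rho> + t = t + \<rho>" "\<rho> + 2 * pi / 3 + t = t + \<rho> + 2 * pi / 3" "\<rho> + 4 * pi / 3 + t = t + \<rho> + 4 * pi / 3" by simp_all
  note hc = hex_centre_inner[OF P, folded c1_def]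
  show False
  proof (rule opposite_label_far)
    show "bad_frame (hex_frame K t)" using t by (simp add: bad_angle_def)
    show "rigid_move t c0 c1 \<bullet> cis \<rho> = support_fun (hex_frame K t) \<rho> - 1/2"
      "rigid_move t c0 c1 \<bullet> cis (\<rho> + 2 * pi / 3) = support_fun (hex_frame K t) (\<rho> + 2 * pi / 3) - 1/2"
      "rigid_move t c0 c1 \<bullet> cis (\<rho> + 4 * pi / 3) = support_fun (hex_frame K t) (\<rho> + 4 * pi / 3) - 1/2"
      unfolding support_fun_hex_frame[OF K] inner_rigid_move e hc c0_def by simp_all
    show "rigid_move t c0 x \<in> hex_frame K t" "rigid_move t c0 y \<in> hex_frame K t"
      using x y by (auto simp: hex_frame_def c0_def)
    show "(rigid_move t c0 x - rigid_move t c0 c1) \<bullet> cis (\<rho> + real_of_int r * pi / 3 + (2 * pi / 3 - tilt)) > 5223061/10000000"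
      "(rigid_move t c0 y - rigid_move t c0 c1) \<bullet> cis (\<rho> + real_of_int r * pi / 3 + tilt) > 5223061/10000000"
      unfolding inner using x y by blast+
  qed (use \<rho> r in auto)
qed

lemma unit_width_coverable:
  assumes K: "unit_width K"
  shows "coverable K"
proof (rule ccontr)
  assume not: "\<not> coverable K"
  \<comment> \<open>A zero is labelled by the parity of a rotation that makes its hexagon bad. Only
    the parity matters for signs, because an odd rotation negates \<open>Pal\<close>; that one zero
    cannot carry both labels is part of the gap condition.\<close>
  define P where "P = {t. \<exists>j::int. bad_angle K (t + of_int (2 * j) * pi / 3)}"
  define N where "N = {t. \<exists>j::int. bad_angle K (t + of_int (2 * j + 1) * pi / 3)}"
  have cont: "continuous_on UNIV (\<lambda>t. support_fun K (t + d))" for d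
    by (rule continuous_on_compose2[OF continuous_support_fun[OF K]]) (intro continuous_intros, auto)
  show False
  proof (rule antiperiodic_root_sign_contradiction)
    show "continuous_on UNIV (Pal K)"
      unfolding Pal_def using cont[of 0] cont by (intro continuous_intros) auto
    show "Pal K (t + pi / 3) = - Pal K t" for t by (rule Pal_anti[OF K])
    show "tilt > 0" by (rule tilt_pos)
    show "Pal K t = 0 \<longleftrightarrow> t \<in> P \<or> t \<in> N" for t
    proof
      assume t: "Pal K t = 0"
      have "\<not> coverable (hex_frame K t)"
        using not coverable_image[of "rigid_move t (hex_centre K t)" K] dist_rigid_move by (auto simp: hex_frame_def)
      then obtain k :: int where k: "bad_frame (hex_frame K (t + of_int k * pi / 3))"
        using std_frame_coverable_or_bad[OF std_hex_frame[OF K t]] hex_frame_rotate[OF K] by auto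
      show "t \<in> P \<or> t \<in> N"
      proof (cases "even k")
        case True
        then obtain j where "k = 2 * j" by (elim evenE)
        then have "bad_angle K (t + of_int (2 * j) * pi / 3)"
          using k Pal_shift_int(1)[OF K, of t j] t unfolding bad_angle_def by simp
        then show ?thesis unfolding P_def by blast
      next
        case False
        then obtain j where "k = 2 * j + 1" by (elim oddE)
        then have "bad_angle K (t + of_int (2 * j + 1) * pi / 3)"
          using k Pal_shift_int(2)[OF K, of t j] t unfolding bad_angle_def by simp
        then show ?thesis unfolding N_def by blast
      qed
    next
      assume "t \<in> P \<or> t \<in> N"
      then show "Pal K t = 0"
        unfolding P_def N_def bad_angle_def mem_Collect_eq Pal_shift_int[OF K] by auto
    qed
    show "t + pi / 3 \<in> N" if "t \<in> P" for t
    proof -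
      from that obtain j where j: "bad_angle K (t + of_int (2 * j) * pi / 3)" by (auto simp only: P_def mem_Collect_eq)
      have "t + of_int (2 * j) * pi / 3 = t + pi / 3 + of_int (2 * (j - 1) + 1) * pi / 3" by (simp add: field_simps)
      with j show ?thesis unfolding N_def mem_Collect_eq by metis
    qed
    show "t + pi / 3 \<in> P" if "t \<in> N" for t
    proof -
      from that obtain j where j: "bad_angle K (t + of_int (2 * j + 1) * pi / 3)" by (auto simp only: N_def mem_Collect_eq)
      have "t + of_int (2 * j + 1) * pi / 3 = t + pi / 3 + of_int (2 * j) * pi / 3" by (simp add: field_simps)
      with j show ?thesis unfolding P_def mem_Collect_eq by metis
    qed
    show "Pal K (t + tilt) > 0" if "t \<in> P" for t
    proof -
      from that obtain j where j: "bad_angle K (t + of_int (2 * j) * pi / 3)" by (auto simp only: P_def mem_Collect_eq)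
      have "t + of_int (2 * j) * pi / 3 + tilt = t + tilt + of_int (2 * j) * pi / 3" by simp
      then show ?thesis using j bad_frame_Pal_pos(1) Pal_hex_frame[OF K] Pal_shift_int(1)[OF K]
        unfolding bad_angle_def by metis
    qed
    show "Pal K (t - tilt) < 0" if "t \<in> N" for t
    proof -
      from that obtain j where j: "bad_angle K (t + of_int (2 * j + 1) * pi / 3)" by (auto simp only: N_def mem_Collect_eq)
      have "t + of_int (2 * j + 1) * pi / 3 + - tilt = t - tilt + of_int (2 * j + 1) * pi / 3" by simp
      then have "- Pal K (t - tilt) > 0" using j bad_frame_Pal_pos(2) Pal_hex_frame[OF K] Pal_shift_int(2)[OF K]
        unfolding bad_angle_def by metis
      then show ?thesis by simp
    qed
    show "\<bar>p - n\<bar> \<ge> tilt" if "p \<in> P" "n \<in> N" for p n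
    proof (rule ccontr)
      assume near: "\<not> ?thesis"
      from that obtain i j where j: "bad_angle K (p + of_int (2 * j) * pi / 3)"
        and i: "bad_angle K (n + of_int (2 * i + 1) * pi / 3)" by (auto simp only: P_def N_def mem_Collect_eq)
      show False
      proof (cases "p \<le> n")
        case True
        have "n + of_int (2 * i + 1) * pi / 3 = p + of_int (2 * j) * pi / 3 + (n - p) + of_int (2 * i + 1 - 2 * j) * pi / 3"
          by (simp add: field_simps)
        with i have i: "bad_angle K (p + of_int (2 * j) * pi / 3 + (n - p) + of_int (2 * i + 1 - 2 * j) * pi / 3)" by metis
        show False by (rule odd_bad_angles_far[OF K j _ _ _ i]) (use True near in auto)
      next
        case False
        have "p + of_int (2 * j) * pi / 3 = n + of_int (2 * i + 1) * pi / 3 + (p - n) + of_int (2 * j - 2 * i - 1) * pi / 3"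
          by (simp add: field_simps)
        with j have j: "bad_angle K (n + of_int (2 * i + 1) * pi / 3 + (p - n) + of_int (2 * j - 2 * i - 1) * pi / 3)" by metis
        show False by (rule odd_bad_angles_far[OF K i _ _ _ j]) (use False near in auto)
      qed
    qed
  qed simp
qed

section \<open>Area of the polygon\<close>

lemma cover_edges_nth:
  "set (zip cover_vertices (tl cover_vertices)) = {(cover_vertices ! i, cover_vertices ! Suc i) | i. i < 32}"
proof -
  have "length cover_vertices = 33" by (simp add: cover_vertices_def)
  then show ?thesis by (auto simp: set_zip nth_tl)
qed

lemma in_cover_region_iff_nth:
  "x \<in> cover_region \<longleftrightarrow> (\<forall>i<32. (snd (cover_vertices ! Suc i) - snd (cover_vertices ! i)) * fst x
     - (fst (cover_vertices ! Suc i) - fst (cover_vertices ! i)) * snd x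
     \<le> cross (cover_vertices ! i) (cover_vertices ! Suc i) / 10000000000)"
proof -
  have "(\<forall>(p, q) \<in> {(V i, V (Suc i)) | i. i < n}. Q p q) \<longleftrightarrow> (\<forall>i<n. Q (V i) (V (Suc i)))"
    for V :: "nat \<Rightarrow> real \<times> real" and n Q by blast
  from this[of "(!) cover_vertices" 32] show ?thesis
    unfolding cover_region_def cover_edges_nth mem_Collect_eq by blast
qed

lemma cover_vertices_cross_pos:
  assumes "i < 32"
  shows "cross (cover_vertices ! i) (cover_vertices ! Suc i) > 0"
proof -
  have "\<forall>(p, q) \<in> set (zip cover_vertices (tl cover_vertices)). cross p q > 0"
    by (simp add: cover_vertices_def cross_def)
  then show ?thesis using assms unfolding cover_edges_nth by blast
qed

definition cover_set :: "(real ^ 2) set" where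
  "cover_set = {x. (x $ 1, x $ 2) \<in> cover_region}"

lemma convex_cover_set: "convex cover_set"
proof (rule convexI)
  fix x y :: "real ^ 2" and u v :: real
  assume x: "x \<in> cover_set" and y: "y \<in> cover_set" and uv: "0 \<le> u" "0 \<le> v" "u + v = 1"
  have le: "a * (u * x1 + v * y1) - b * (u * x2 + v * y2) \<le> d"
    if "a * x1 - b * x2 \<le> d" "a * y1 - b * y2 \<le> d" for a b d x1 x2 y1 y2
  proof -
    have "u * (a * x1 - b * x2) + v * (a * y1 - b * y2) \<le> d" by (rule convex_bound_le[OF that uv])
    then show ?thesis by (simp add: algebra_simps)
  qed
  have "(u *\<^sub>R x + v *\<^sub>R y) $ i = u * x $ i + v * y $ i" for i by simp
  then show "u *\<^sub>R x + v *\<^sub>R y \<in> cover_set"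
    using x y le unfolding cover_set_def mem_Collect_eq in_cover_region_iff_nth fst_conv snd_conv by metis
qed

text \<open>Without such an index nonnegativity would propagate around the cycle and become strict
  everywhere, against \<open>i1\<close>. Applied to the cross products of the vertices with a point,
  it finds the sector containing that point.\<close>

lemma cyclic_sign_change:
  fixes f :: "nat \<Rightarrow> real"
  assumes n: "f n = f 0" and i0: "i0 \<le> n" "f i0 \<ge> 0" and i1: "i1 \<le> n" "f i1 \<le> 0" and "n > 0"
  shows "\<exists>i<n. f i \<ge> 0 \<and> f (Suc i) \<le> 0"
proof (rule ccontr)
  assume "\<not> ?thesis"
  then have step: "f (Suc i) > 0" if "i < n" "f i \<ge> 0" for i using that by (auto simp: not_le)
  have up: "f j \<ge> 0" if "i \<le> j" "j \<le> n" "f i \<ge> 0" for i j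
    using that by (induction rule: dec_induct) (auto intro!: less_imp_le[OF step])
  have "f 0 \<ge> 0" using up[OF i0(1) order_refl i0(2)] n by simp
  then have nonneg: "f j \<ge> 0" if "j \<le> n" for j using up[OF _ that, of 0] by simp
  have pos: "f (Suc j) > 0" if "Suc j \<le> n" for j using that nonneg[of j] step[of j] by simp
  have "f n > 0" using pos[of "n - 1"] \<open>n > 0\<close> by simp
  then have "f i1 > 0" using n pos[of "i1 - 1"] i1(1) by (cases i1) auto
  then show False using i1 by simp
qed

text \<open>The four vertices with indices 0, 1, 27 and 28 already surround the origin, so they
  cannot all lie strictly on one side of a line through it.\<close>

lemma some_cover_vertex_left_and_right:
  "\<exists>i\<le>32. cross (cover_vertices ! i) x \<ge> 0" "\<exists>i\<le>32. cross (cover_vertices ! i) x \<le> 0"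
proof -
  have v: "cover_vertices ! 0 = (5000000020, -1265000585)" "cover_vertices ! 1 = (5000000020, 2886751357)"
    "cover_vertices ! 27 = (-5000000020, 2886751357)" "cover_vertices ! 28 = (-5000000020, -1415054245)"
    by (simp_all add: cover_vertices_def)
  have *: "(\<exists>i\<in>{0, 1, 27, 28}. cross (cover_vertices ! i) x \<ge> 0) \<and> (\<exists>i\<in>{0, 1, 27, 28}. cross (cover_vertices ! i) x \<le> 0)"
    unfolding bex_simps v cross_def fst_conv snd_conv by argo
  then show "\<exists>i\<le>32. cross (cover_vertices ! i) x \<ge> 0" "\<exists>i\<le>32. cross (cover_vertices ! i) x \<le> 0"
    using bspec[of "{0, 1, 27, 28}" "\<lambda>i. i \<le> (32::nat)"] by auto
qed

definition fan_point :: "real \<times> real \<Rightarrow> real ^ 2" where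
  "fan_point p = vector [fst p / 10000000000, snd p / 10000000000]"

lemma cover_set_subset_fan:
  "cover_set \<subseteq> (\<Union>i<32. convex hull {0, fan_point (cover_vertices ! i), fan_point (cover_vertices ! Suc i)})"
proof
  fix x assume "x \<in> cover_set"
  then have x: "(x $ 1, x $ 2) \<in> cover_region" by (simp add: cover_set_def)
  have "cover_vertices ! 32 = cover_vertices ! 0" by (simp add: cover_vertices_def)
  then obtain i where i: "i < 32" "cross (cover_vertices ! i) (x $ 1, x $ 2) \<ge> 0"
      "cross (cover_vertices ! Suc i) (x $ 1, x $ 2) \<le> 0"
    using some_cover_vertex_left_and_right[of "(x $ 1, x $ 2)"]
      cyclic_sign_change[of "\<lambda>i. cross (cover_vertices ! i) (x $ 1, x $ 2)" 32] by auto
  define p q where "p = cover_vertices ! i" and "q = cover_vertices ! Suc i"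
  define D where "D = cross p q"
  \<comment> \<open>The coordinates of \<open>x\<close> with respect to the two scaled-down vertices
    by Cramer's rule. The sign change makes them nonnegative, and the edge inequality says that
    their sum is at most 1.\<close>
  define \<alpha> \<beta> where "\<alpha> = - 10000000000 * cross q (x $ 1, x $ 2) / D" and "\<beta> = 10000000000 * cross p (x $ 1, x $ 2) / D"
  have D: "D > 0" unfolding D_def p_def q_def by (rule cover_vertices_cross_pos[OF i(1)])
  have ab: "\<alpha> \<ge> 0" "\<beta> \<ge> 0" using i(2,3) D by (auto simp: \<alpha>_def \<beta>_def p_def q_def divide_nonpos_pos)
  have "(snd q - snd p) * x $ 1 - (fst q - fst p) * x $ 2 \<le> D / 10000000000"
    using x i(1) unfolding in_cover_region_iff_nth p_def q_def D_def by auto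
  then have "10000000000 * (cross p (x $ 1, x $ 2) - cross q (x $ 1, x $ 2)) \<le> D"
    by (simp add: cross_def algebra_simps)
  then have "10000000000 * (cross p (x $ 1, x $ 2) - cross q (x $ 1, x $ 2)) / D \<le> 1" using D by simp
  then have sum: "\<alpha> + \<beta> \<le> 1" unfolding \<alpha>_def \<beta>_def by (simp add: add_divide_distrib[symmetric] diff_divide_distrib algebra_simps)
  have "D * x $ 1 = fst q * cross p (x $ 1, x $ 2) - fst p * cross q (x $ 1, x $ 2)"
    "D * x $ 2 = snd q * cross p (x $ 1, x $ 2) - snd p * cross q (x $ 1, x $ 2)"
    by (simp_all add: D_def cross_def algebra_simps)
  then have "x $ 1 = (fst q * cross p (x $ 1, x $ 2) - fst p * cross q (x $ 1, x $ 2)) / D"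
    "x $ 2 = (snd q * cross p (x $ 1, x $ 2) - snd p * cross q (x $ 1, x $ 2)) / D"
    using D by (simp_all add: eq_divide_eq mult.commute)
  then have "x $ 1 = \<alpha> * (fst p / 10000000000) + \<beta> * (fst q / 10000000000)"
    "x $ 2 = \<alpha> * (snd p / 10000000000) + \<beta> * (snd q / 10000000000)"
    by (simp_all add: \<alpha>_def \<beta>_def diff_divide_distrib mult.commute)
  then have "x = 0 + \<alpha> *\<^sub>R (fan_point p - 0) + \<beta> *\<^sub>R (fan_point q - 0)"
    by (simp add: vec_eq_iff forall_2 fan_point_def)
  then have "x \<in> convex hull {0, fan_point p, fan_point q}"
    unfolding convex_hull_3_alt using ab sum by blast
  then show "x \<in> (\<Union>i<32. convex hull {0, fan_point (cover_vertices ! i), fan_point (cover_vertices ! Suc i)})"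
    using i(1) by (auto simp: p_def q_def)
qed

lemma emeasure_fan_triangle:
  "emeasure lebesgue (convex hull {0, fan_point p, fan_point q}) = ennreal (\<bar>cross p q\<bar> / (2 * 10000000000 ^ 2))"
proof -
  have c: "compact (convex hull {0, fan_point p, fan_point q})" by (intro finite_imp_compact_convex_hull) simp
  have "emeasure lebesgue (convex hull {0, fan_point p, fan_point q})
      = ennreal (measure lebesgue (convex hull {0, fan_point p, fan_point q}))"
    using c by (intro emeasure_eq_measure2 lmeasurable_compact)
  also have "measure lebesgue (convex hull {0, fan_point p, fan_point q})
      = measure lborel (convex hull {0, fan_point p, fan_point q})"
    using compact_imp_closed[OF c] by (intro measure_completion) simp
  also have "\<dots> = \<bar>- cross p q / 10000000000 ^ 2\<bar> / 2"
    unfolding content_triangle by (simp add: fan_point_def cross_def power2_eq_square field_simps)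
  finally show ?thesis by (simp add: abs_divide field_simps)
qed

lemma emeasure_cover_set: "emeasure lebesgue cover_set \<le> ennreal 0.8440935944"
proof -
  let ?T = "\<lambda>i. convex hull {0, fan_point (cover_vertices ! i), fan_point (cover_vertices ! Suc i)}"
  let ?c = "\<lambda>i. cross (cover_vertices ! i) (cover_vertices ! Suc i)"
  have sets: "?T i \<in> sets lebesgue" for i
    by (intro fmeasurableD lmeasurable_compact finite_imp_compact_convex_hull) simp
  have "(\<Sum>i<32. ?c i) = (\<Sum>(p, q)\<leftarrow>zip cover_vertices (tl cover_vertices). cross p q)"
  proof -
    have "length cover_vertices = 33" by (simp add: cover_vertices_def)
    then show ?thesis unfolding sum_list_sum_nth by (intro sum.cong) (auto simp: nth_tl)
  qed
  \<comment> \<open>The shoelace sum, which is twice the area in the scaled coordinates: the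
    constant is 2 * 0.8440935944 times the square of the scale factor.\<close>
  also have "\<dots> \<le> 168818718880000000000"
    by (simp add: cover_vertices_def cross_def)
  finally have le: "(\<Sum>i<32. ?c i) \<le> 168818718880000000000" .
  have "emeasure lebesgue cover_set \<le> emeasure lebesgue (\<Union>i<32. ?T i)"
    by (intro emeasure_mono cover_set_subset_fan sets.finite_UN sets) simp
  also have "\<dots> \<le> (\<Sum>i<32. emeasure lebesgue (?T i))"
    using sets by (intro emeasure_subadditive_finite) auto
  also have "\<dots> = (\<Sum>i<32. ennreal (?c i / (2 * 10000000000 ^ 2)))"
    unfolding emeasure_fan_triangle using cover_vertices_cross_pos by (intro sum.cong) (auto simp: abs_of_pos)
  also have "\<dots> = ennreal (\<Sum>i<32. ?c i / (2 * 10000000000 ^ 2))"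
    using cover_vertices_cross_pos by (intro sum_ennreal) (auto intro: less_imp_le)
  also have "\<dots> \<le> ennreal 0.8440935944"
  proof (rule ennreal_leI)
    have "(\<Sum>i<32. ?c i / (2 * 10000000000 ^ 2)) = (\<Sum>i<32. ?c i) / (2 * 10000000000 ^ 2)"
      by (rule sum_divide_distrib[symmetric])
    also have "\<dots> \<le> 168818718880000000000 / (2 * 10000000000 ^ 2)" using le by (rule divide_right_mono) simp
    also have "\<dots> = 0.8440935944" by simp
    finally show "(\<Sum>i<32. ?c i / (2 * 10000000000 ^ 2)) \<le> 0.8440935944" .
  qed
  finally show ?thesis .
qed

lemma covering_cover_set: "covering_for unit_diameter_sets cover_set"
  unfolding covering_for_def
proof
  \<comment> \<open>Coordinate isometries between the two models of the plane; the geometry takes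
    place in \<open>complex\<close>, where a rotation is a multiplication by
    \<open>cis\<close>.\<close>
  define to_c :: "real ^ 2 \<Rightarrow> complex" where "to_c x = Complex (x $ 1) (x $ 2)" for x
  define of_c :: "complex \<Rightarrow> real ^ 2" where "of_c z = vector [Re z, Im z]" for z
  have dist_to_c: "dist (to_c x) (to_c y) = dist x y" for x y
    by (simp add: to_c_def dist_norm cmod_def norm_vec_def L2_set_def sum_2)
  have dist_of_c: "dist (of_c x) (of_c y) = dist x y" for x y
    by (simp add: of_c_def dist_norm cmod_def norm_vec_def L2_set_def sum_2)
  fix S :: "(real ^ 2) set" assume S: "S \<in> unit_diameter_sets"
  have "dist x y \<le> 1" if "x \<in> to_c ` S" "y \<in> to_c ` S" for x y
    using that S diameter_bounded_bound[of S] by (auto simp: dist_to_c unit_diameter_sets_def)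
  then obtain K where K: "to_c ` S \<subseteq> K" "unit_width K" using unit_width_completion by metis
  obtain f where f: "\<forall>x y. dist (f x) (f y) = dist x y" "\<forall>x\<in>K. (Re (f x), Im (f x)) \<in> cover_region"
    using unit_width_coverable[OF K(2)] by (auto simp: coverable_def)
  define F where "F x = of_c (f (to_c x))" for x
  have "congruent_sets S (F ` S)"
    unfolding congruent_sets_def using f(1) by (intro exI[of _ F]) (simp add: F_def dist_of_c dist_to_c)
  moreover have "F ` S \<subseteq> cover_set"
    using f(2) K(1) by (auto simp: F_def cover_set_def of_c_def)
  ultimately show "\<exists>T\<subseteq>cover_set. congruent_sets S T" by blast
qed

theorem mainTheorem2:
  shows "min_convex_covering_area \<le> ennreal 0.8440935944"
  unfolding min_convex_covering_area_def
  using convex_cover_set covering_cover_set by (intro INF_lower2[of cover_set] emeasure_cover_set) simp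

end
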